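(* Let $M$ be a compact manifold, $I=[0,T]$, and let $g(t)$, $t\in I$, be a Ricci flow on $M$, i.e. $\partial g/\partial t=-2\,{\rm Ric}_{g}$. Let $\widehat C<\infty$ be a constant depending only on this Ricci flow such that for every smooth family of immersed curves $S^1\times I\to M$ satisfying the curve-shrinking equation in $(M,g(t))_{t\in I}$, $$\frac{\partial}{\partial t}k^2\le (k^2)''-2\langle(\nabla_SH)^\perp,(\nabla_SH)^\perp\rangle+2k^4+\widehat C(k^2+k),$$ and put $C_1=\widehat C/2$. Let $C_2$ be an upper bound for $|{\rm Ric}_g|$ over $M\times I$. Let $c\colon S^1\times I\to M$ be a smooth family of immersed curves satisfying the curve-shrinking equation $\partial c/\partial t=H$, with total length $L(t)=\int ds$ and total curvature $\Theta(t)=\int k\,ds$ at time $t$. Then $$\frac{d}{dt}L\le\int (C_2-k^2)\,ds$$ and $$\frac{d}{dt}\Theta\le (C_1+C_2)\Theta+C_1L.$$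
   Context: $\nabla^g$ denotes the family of Levi-Civita connections of the metrics $g(t)$ and ${\rm Ric}_g$ their Ricci tensors. For a curve-shrinking flow $c$: $X(x,t)$ is the tangent vector $\partial c/\partial x$, $|X|$ its $g(t)$-length, $S=X/|X|$ the unit tangent field, $H=\nabla^g_SS$ the curvature vector, $k=|H|$, and $ds=|X|\,dx$; thus $L(t)=\int_{S^1}|X|(x,t)\,dx$ and $\Theta(t)=\int_{S^1}k(x,t)|X|(x,t)\,dx$. In the inequality defining $\widehat C$: $\hat g$ is the metric on $M\times I$ that is the orthogonal sum of the varying family $g(t)$ and the usual metric on $I$; inner products are with respect to $\hat g$; $\nabla$ is its Levi-Civita connection; $S$ and $H$ are regarded as vector fields along the immersion $\hat c(x,t)=(c(x,t),t)$ tangent to the $M$-factor, and $\nabla_S$ is covariant differentiation along $\hat c$ in direction $S$; $\perp$ denotes the component orthogonal to $S$ (equivalently, to $X$); $\partial/\partial t$ is taken at fixed $x$; and $'$ denotes the derivative with respect to arc length, $f'=S(f)=|X|^{-1}\partial_xf$. (A constant $\widehat C$ with this property, depending only on the Ricci flow, exists.)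
   Formalization: The constant Ĉ is taken to be nonnegative (for negative Ĉ the claim fails on a static circle), and since Θ need not be differentiable where k vanishes, the bound on dΘ/dt is stated for the two-sided limsup of difference quotients; T>0 is assumed. *)

theory Defs
  imports "HOL-Analysis.Analysis"
begin

section \<open>Smooth maps\<close>

text \<open>The set \<open>S\<close> is always open, a product of an open set with \<open>{0..T}\<close>, or relatively open in
  \<open>UNIV \<times> {0..T}\<close>, with \<open>T > 0\<close>. Derivatives within such a set are unique, and smoothness is meant
  up to the boundary points that belong to \<open>S\<close>.\<close>

primrec Ck_on ::
  "nat \<Rightarrow> 'a::real_normed_vector set \<Rightarrow> ('a \<Rightarrow> 'b::real_normed_vector) \<Rightarrow> bool" where
  "Ck_on 0 S f \<longleftrightarrow> continuous_on S f"
| "Ck_on (Suc n) S f \<longleftrightarrow>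
     f differentiable_on S \<and> (\<forall>v. Ck_on n S (\<lambda>x. frechet_derivative f (at x within S) v))"

definition smooth_on ::
  "'a::real_normed_vector set \<Rightarrow> ('a \<Rightarrow> 'b::real_normed_vector) \<Rightarrow> bool" where
  "smooth_on S f \<longleftrightarrow> (\<forall>n. Ck_on n S f)"


section \<open>Manifolds and metrics\<close>

text \<open>A manifold is a type \<open>'m\<close> of points with a smooth atlas modelled on \<open>'a\<close>; a chart is a pair of
  a domain and a coordinate map. Tangent vectors and tensors are given by their components in the
  charts, and a tensor field is a family of component functions, one for each chart and defined
  on its image, obeying the usual transformation rule.\<close>

type_synonym ('m, 'a) chart = "'m set \<times> ('m \<Rightarrow> 'a)"

abbreviation dom_chart :: "('m, 'a) chart \<Rightarrow> 'm set" where
  "dom_chart \<equiv> fst"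

abbreviation coord :: "('m, 'a) chart \<Rightarrow> 'm \<Rightarrow> 'a" where
  "coord \<equiv> snd"

abbreviation img_chart :: "('m, 'a) chart \<Rightarrow> 'a set" where
  "img_chart \<kappa> \<equiv> coord \<kappa> ` dom_chart \<kappa>"

definition transition :: "('m, 'a) chart \<Rightarrow> ('m, 'a) chart \<Rightarrow> 'a \<Rightarrow> 'a" where
  "transition \<kappa> \<mu> x = coord \<mu> (inv_into (dom_chart \<kappa>) (coord \<kappa>) x)"

definition smooth_atlas ::
  "('m::topological_space, 'a::euclidean_space) chart set \<Rightarrow> bool" where
  "smooth_atlas A \<longleftrightarrow>
     (\<Union>\<kappa>\<in>A. dom_chart \<kappa>) = UNIV \<and>
     (\<forall>\<kappa>\<in>A. open (dom_chart \<kappa>) \<and> open (img_chart \<kappa>) \<and>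
        (\<exists>\<psi>. homeomorphism (dom_chart \<kappa>) (img_chart \<kappa>) (coord \<kappa>) \<psi>)) \<and>
     (\<forall>\<kappa>\<in>A. \<forall>\<mu>\<in>A.
        smooth_on (coord \<kappa> ` (dom_chart \<kappa> \<inter> dom_chart \<mu>)) (transition \<kappa> \<mu>))"

text \<open>Scalars built from tensors do not depend on the chart; they are evaluated in this one.\<close>

definition chart_at :: "('m, 'a) chart set \<Rightarrow> 'm \<Rightarrow> ('m, 'a) chart" where
  "chart_at A p = (SOME \<kappa>. \<kappa> \<in> A \<and> p \<in> dom_chart \<kappa>)"

text \<open>A covariant 2-tensor field on an open subset of a vector space: point, then two vectors.\<close>

type_synonym 'v field2 = "'v \<Rightarrow> 'v \<Rightarrow> 'v \<Rightarrow> real"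

type_synonym ('m, 'a) metric = "('m, 'a) chart \<Rightarrow> 'a field2"

definition inner_form :: "('v::real_vector \<Rightarrow> 'v \<Rightarrow> real) \<Rightarrow> bool" where
  "inner_form B \<longleftrightarrow> bilinear B \<and> (\<forall>u v. B u v = B v u) \<and> (\<forall>u. u \<noteq> 0 \<longrightarrow> B u u > 0)"

definition smooth_metric_family ::
  "('m, 'a::euclidean_space) chart set \<Rightarrow> real \<Rightarrow> (real \<Rightarrow> ('m, 'a) metric) \<Rightarrow> bool" where
  "smooth_metric_family A T g \<longleftrightarrow>
     (\<forall>\<kappa>\<in>A. \<forall>t\<in>{0..T}. \<forall>x\<in>img_chart \<kappa>. inner_form (g t \<kappa> x)) \<and>
     (\<forall>\<kappa>\<in>A. \<forall>u v. smooth_on (img_chart \<kappa> \<times> {0..T}) (\<lambda>(x, t). g t \<kappa> x u v)) \<and>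
     (\<forall>\<kappa>\<in>A. \<forall>\<mu>\<in>A. \<forall>t\<in>{0..T}. \<forall>x\<in>coord \<kappa> ` (dom_chart \<kappa> \<inter> dom_chart \<mu>). \<forall>u v.
        g t \<kappa> x u v =
          g t \<mu> (transition \<kappa> \<mu> x)
            (frechet_derivative (transition \<kappa> \<mu>) (at x) u)
            (frechet_derivative (transition \<kappa> \<mu>) (at x) v))"


section \<open>Levi-Civita connection and Ricci curvature in coordinates\<close>

text \<open>\<open>D\<close> is the domain of the metric \<open>G\<close>: the image of a chart, or the product of such an image
  with the time interval. The Christoffel map is \<open>\<nabla>\<^sub>u v\<close> for vector fields \<open>u\<close>, \<open>v\<close> with constant
  components, characterised by the Koszul formula.\<close>

definition metric_deriv :: "'v::euclidean_space set \<Rightarrow> 'v field2 \<Rightarrow> 'v \<Rightarrow> 'v \<Rightarrow> 'v \<Rightarrow> 'v \<Rightarrow> real"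
  where
  "metric_deriv D G p w u v = frechet_derivative (\<lambda>q. G q u v) (at p within D) w"

definition christoffel :: "'v::euclidean_space set \<Rightarrow> 'v field2 \<Rightarrow> 'v \<Rightarrow> 'v \<Rightarrow> 'v \<Rightarrow> 'v" where
  "christoffel D G p u v =
     (THE w. \<forall>z. 2 * G p w z =
        metric_deriv D G p u v z + metric_deriv D G p v u z - metric_deriv D G p z u v)"

text \<open>\<open>\<nabla>\<close> along the curve \<open>\<gamma>\<close> of the vector field \<open>V\<close> along \<open>\<gamma>\<close>, in the direction of the parameter.\<close>

definition cov_deriv_along ::
  "'v::euclidean_space set \<Rightarrow> 'v field2 \<Rightarrow> (real \<Rightarrow> 'v) \<Rightarrow> (real \<Rightarrow> 'v) \<Rightarrow> real \<Rightarrow> 'v" where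
  "cov_deriv_along D G \<gamma> V x =
     vector_derivative V (at x)
     + christoffel D G (\<gamma> x) (vector_derivative \<gamma> (at x)) (V x)"

text \<open>Sign convention: \<open>R(u,v)w = \<nabla>\<^sub>u\<nabla>\<^sub>v w - \<nabla>\<^sub>v\<nabla>\<^sub>u w - \<nabla>\<^bsub>[u,v]\<^esub> w\<close>, and \<open>Ric(v,w)\<close> is the trace of
  \<open>u \<mapsto> R(u,v)w\<close>, so that round spheres have positive Ricci curvature.\<close>

definition riemann :: "'v::euclidean_space set \<Rightarrow> 'v field2 \<Rightarrow> 'v \<Rightarrow> 'v \<Rightarrow> 'v \<Rightarrow> 'v \<Rightarrow> 'v" where
  "riemann D G p u v w =
     frechet_derivative (\<lambda>q. christoffel D G q v w) (at p within D) u
     - frechet_derivative (\<lambda>q. christoffel D G q u w) (at p within D) v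
     + christoffel D G p u (christoffel D G p v w)
     - christoffel D G p v (christoffel D G p u w)"

definition ricci :: "'v::euclidean_space set \<Rightarrow> 'v field2 \<Rightarrow> 'v field2" where
  "ricci D G p v w = (\<Sum>e\<in>Basis. riemann D G p e v w \<bullet> e)"

text \<open>The norm of a 2-tensor \<open>B\<close> for the inner product \<open>G\<close>: the square root of the sum of the
  squares of its components in a \<open>G\<close>-orthonormal basis, here indexed by \<open>Basis\<close>. The value does
  not depend on that basis.\<close>

definition tensor_norm ::
  "('v::euclidean_space \<Rightarrow> 'v \<Rightarrow> real) \<Rightarrow> ('v \<Rightarrow> 'v \<Rightarrow> real) \<Rightarrow> real" where
  "tensor_norm G B =
     (let e = (SOME e. \<forall>i\<in>Basis. \<forall>j\<in>Basis. G (e i) (e j) = (if i = (j::'v) then 1 else 0))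
      in sqrt (\<Sum>i\<in>Basis. \<Sum>j\<in>Basis. (B (e i) (e j))\<^sup>2))"

definition ricci_norm ::
  "('m, 'a::euclidean_space) chart set \<Rightarrow> (real \<Rightarrow> ('m, 'a) metric) \<Rightarrow> real \<Rightarrow> 'm \<Rightarrow> real" where
  "ricci_norm A g t p =
     (let \<kappa> = chart_at A p; x = coord \<kappa> p
      in tensor_norm (g t \<kappa> x) (ricci (img_chart \<kappa>) (g t \<kappa>) x))"

definition ricci_flow ::
  "('m, 'a::euclidean_space) chart set \<Rightarrow> real \<Rightarrow> (real \<Rightarrow> ('m, 'a) metric) \<Rightarrow> bool" where
  "ricci_flow A T g \<longleftrightarrow>
     smooth_metric_family A T g \<and>
     (\<forall>\<kappa>\<in>A. \<forall>x\<in>img_chart \<kappa>. \<forall>t\<in>{0..T}. \<forall>u v.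
        ((\<lambda>s. g s \<kappa> x u v) has_real_derivative - 2 * ricci (img_chart \<kappa>) (g t \<kappa>) x u v)
          (at t within {0..T}))"


section \<open>Curves\<close>

text \<open>The circle is \<open>\<real> / 2\<pi>\<int>\<close>: a family of closed curves is a map \<open>(x, t) \<mapsto> c (x, t)\<close>, \<open>t \<in> {0..T}\<close>,
  of period \<open>2\<pi>\<close> in \<open>x\<close>.\<close>

type_synonym 'm curves = "real \<times> real \<Rightarrow> 'm"

text \<open>Components in the chart \<open>\<kappa>\<close> of \<open>X = \<partial>c/\<partial>x\<close>, \<open>S = X/|X|\<close> and \<open>H = \<nabla>\<^sub>S S = |X|\<inverse> \<nabla>\<^sub>X S\<close>; they are
  meaningful where \<open>c\<close> lies in the domain of \<open>\<kappa>\<close>.\<close>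

definition tangent_in :: "('m, 'a::euclidean_space) chart \<Rightarrow> 'm curves \<Rightarrow> real \<times> real \<Rightarrow> 'a" where
  "tangent_in \<kappa> c = (\<lambda>(x, t). vector_derivative (\<lambda>y. coord \<kappa> (c (y, t))) (at x))"

definition length_in ::
  "('m, 'a::euclidean_space) chart \<Rightarrow> (real \<Rightarrow> ('m, 'a) metric) \<Rightarrow> 'm curves
    \<Rightarrow> (real \<times> real \<Rightarrow> 'a) \<Rightarrow> real \<times> real \<Rightarrow> real" where
  "length_in \<kappa> g c V = (\<lambda>(x, t). sqrt (g t \<kappa> (coord \<kappa> (c (x, t))) (V (x, t)) (V (x, t))))"

definition unit_tangent_in ::
  "('m, 'a::euclidean_space) chart \<Rightarrow> (real \<Rightarrow> ('m, 'a) metric) \<Rightarrow> 'm curves \<Rightarrow> real \<times> real \<Rightarrow> 'a"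
  where
  "unit_tangent_in \<kappa> g c z = tangent_in \<kappa> c z /\<^sub>R length_in \<kappa> g c (tangent_in \<kappa> c) z"

definition curvature_in ::
  "('m, 'a::euclidean_space) chart \<Rightarrow> (real \<Rightarrow> ('m, 'a) metric) \<Rightarrow> 'm curves \<Rightarrow> real \<times> real \<Rightarrow> 'a"
  where
  "curvature_in \<kappa> g c = (\<lambda>(x, t).
     cov_deriv_along (img_chart \<kappa>) (g t \<kappa>)
         (\<lambda>y. coord \<kappa> (c (y, t))) (\<lambda>y. unit_tangent_in \<kappa> g c (y, t)) x
       /\<^sub>R length_in \<kappa> g c (tangent_in \<kappa> c) (x, t))"

definition speed ::
  "('m, 'a::euclidean_space) chart set \<Rightarrow> (real \<Rightarrow> ('m, 'a) metric) \<Rightarrow> 'm curves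
    \<Rightarrow> real \<times> real \<Rightarrow> real" where
  "speed A g c z = (let \<kappa> = chart_at A (c z) in length_in \<kappa> g c (tangent_in \<kappa> c) z)"

definition curvature ::
  "('m, 'a::euclidean_space) chart set \<Rightarrow> (real \<Rightarrow> ('m, 'a) metric) \<Rightarrow> 'm curves
    \<Rightarrow> real \<times> real \<Rightarrow> real" where
  "curvature A g c z = (let \<kappa> = chart_at A (c z) in length_in \<kappa> g c (curvature_in \<kappa> g c) z)"

definition immersed_curve_family ::
  "('m::topological_space, 'a::euclidean_space) chart set \<Rightarrow> real \<Rightarrow> 'm curves \<Rightarrow> bool" where
  "immersed_curve_family A T c \<longleftrightarrow>
     (\<forall>x. \<forall>t\<in>{0..T}. c (x + 2 * pi, t) = c (x, t)) \<and>
     continuous_on (UNIV \<times> {0..T}) c \<and>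
     (\<forall>\<kappa>\<in>A. smooth_on {z \<in> UNIV \<times> {0..T}. c z \<in> dom_chart \<kappa>} (\<lambda>z. coord \<kappa> (c z))) \<and>
     (\<forall>\<kappa>\<in>A. \<forall>z \<in> UNIV \<times> {0..T}. c z \<in> dom_chart \<kappa> \<longrightarrow> tangent_in \<kappa> c z \<noteq> 0)"

definition curve_shrinking_flow ::
  "('m::topological_space, 'a::euclidean_space) chart set \<Rightarrow> real \<Rightarrow> (real \<Rightarrow> ('m, 'a) metric)
    \<Rightarrow> 'm curves \<Rightarrow> bool" where
  "curve_shrinking_flow A T g c \<longleftrightarrow>
     immersed_curve_family A T c \<and>
     (\<forall>\<kappa>\<in>A. \<forall>x. \<forall>t\<in>{0..T}. c (x, t) \<in> dom_chart \<kappa> \<longrightarrow>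
        ((\<lambda>s. coord \<kappa> (c (x, s))) has_vector_derivative curvature_in \<kappa> g c (x, t))
          (at t within {0..T}))"

definition time_deriv :: "real \<Rightarrow> (real \<times> real \<Rightarrow> real) \<Rightarrow> real \<times> real \<Rightarrow> real" where
  "time_deriv T f = (\<lambda>(x, t). vector_derivative (\<lambda>s. f (x, s)) (at t within {0..T}))"

definition arc_deriv ::
  "('m, 'a::euclidean_space) chart set \<Rightarrow> (real \<Rightarrow> ('m, 'a) metric) \<Rightarrow> 'm curves
    \<Rightarrow> (real \<times> real \<Rightarrow> real) \<Rightarrow> real \<times> real \<Rightarrow> real" where
  "arc_deriv A g c f = (\<lambda>(x, t). deriv (\<lambda>y. f (y, t)) x / speed A g c (x, t))"

definition arc_integral ::
  "('m, 'a::euclidean_space) chart set \<Rightarrow> (real \<Rightarrow> ('m, 'a) metric) \<Rightarrow> 'm curves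
    \<Rightarrow> real \<Rightarrow> (real \<times> real \<Rightarrow> real) \<Rightarrow> real" where
  "arc_integral A g c t f = integral {0..2 * pi} (\<lambda>x. f (x, t) * speed A g c (x, t))"

definition total_length ::
  "('m, 'a::euclidean_space) chart set \<Rightarrow> (real \<Rightarrow> ('m, 'a) metric) \<Rightarrow> 'm curves \<Rightarrow> real \<Rightarrow> real"
  where
  "total_length A g c t = arc_integral A g c t (\<lambda>_. 1)"

definition total_curvature ::
  "('m, 'a::euclidean_space) chart set \<Rightarrow> (real \<Rightarrow> ('m, 'a) metric) \<Rightarrow> 'm curves \<Rightarrow> real \<Rightarrow> real"
  where
  "total_curvature A g c t = arc_integral A g c t (curvature A g c)"


section \<open>The space-time metric\<close>

text \<open>Components, in the product of a chart with the time coordinate, of the orthogonal sum of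
  \<open>g t\<close> and \<open>dt\<^sup>2\<close>; its domain is \<open>img_chart \<kappa> \<times> {0..T}\<close>.\<close>

definition spacetime_metric ::
  "(real \<Rightarrow> ('m, 'a) metric) \<Rightarrow> ('m, 'a) chart \<Rightarrow> ('a \<times> real) field2" where
  "spacetime_metric g \<kappa> = (\<lambda>(x, t) (u, a) (v, b). g t \<kappa> x u v + a * b)"

text \<open>\<open>\<nabla>\<^sub>S H\<close> for the space-time connection, along the curve \<open>y \<mapsto> (c (y, t), t)\<close>. It has a
  component in the time direction in general.\<close>

definition spacetime_cov_curvature_in ::
  "('m, 'a::euclidean_space) chart \<Rightarrow> real \<Rightarrow> (real \<Rightarrow> ('m, 'a) metric) \<Rightarrow> 'm curves
    \<Rightarrow> real \<times> real \<Rightarrow> 'a \<times> real" where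
  "spacetime_cov_curvature_in \<kappa> T g c = (\<lambda>(x, t).
     cov_deriv_along (img_chart \<kappa> \<times> {0..T}) (spacetime_metric g \<kappa>)
         (\<lambda>y. (coord \<kappa> (c (y, t)), t)) (\<lambda>y. (curvature_in \<kappa> g c (y, t), 0)) x
       /\<^sub>R length_in \<kappa> g c (tangent_in \<kappa> c) (x, t))"

text \<open>\<open>\<langle>(\<nabla>\<^sub>S H)\<^sup>\<bottom>, (\<nabla>\<^sub>S H)\<^sup>\<bottom>\<rangle>\<close>, where \<open>\<bottom>\<close> is the component orthogonal to \<open>S\<close> in space-time.\<close>

definition normal_cov_curvature_sq ::
  "('m, 'a::euclidean_space) chart set \<Rightarrow> real \<Rightarrow> (real \<Rightarrow> ('m, 'a) metric) \<Rightarrow> 'm curves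
    \<Rightarrow> real \<times> real \<Rightarrow> real" where
  "normal_cov_curvature_sq A T g c = (\<lambda>(x, t).
     let \<kappa> = chart_at A (c (x, t));
         ip = spacetime_metric g \<kappa> (coord \<kappa> (c (x, t)), t);
         W = spacetime_cov_curvature_in \<kappa> T g c (x, t);
         S = (unit_tangent_in \<kappa> g c (x, t), 0);
         N = W - ip W S *\<^sub>R S
     in ip N N)"


section \<open>Upper derivative\<close>

text \<open>The total curvature need not be differentiable in time, since \<open>k = |H|\<close> is only Lipschitz where
  \<open>H = 0\<close>. An upper bound for its derivative is a bound for the limsup of all difference quotients,
  forward and backward; where the derivative exists, this limsup is the derivative.\<close>

definition upper_deriv :: "(real \<Rightarrow> real) \<Rightarrow> real \<Rightarrow> real set \<Rightarrow> ereal" where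
  "upper_deriv f t I = Limsup (at t within I) (\<lambda>s. ereal ((f s - f t) / (s - t)))"

end

theory Submission
  imports Defs
begin

text \<open>
  By the flow equation, the coordinates of \<open>H\<close> are the time derivatives of the coordinates of the
  curve. Hence \<open>|X|\<^sup>2\<close> and \<open>k\<^sup>2\<close> are smooth and independent of the chart without any computation with
  Christoffel symbols, and the Koszul formula together with \<open>\<partial>\<^sub>t X = \<partial>\<^sub>x H\<close> gives
  \<open>\<partial>\<^sub>t |X| = (- Ric(S,S) - k\<^sup>2) |X|\<close>; integrating over the circle yields the estimate for the length.

  For the total curvature, replace \<open>k\<close> by the smooth function \<open>k\<^sub>\<epsilon> = sqrt (k\<^sup>2 + \<epsilon>\<^sup>2)\<close>. Since
  \<open>(k\<^sup>2)' = 2 \<langle>(\<nabla>\<^sub>S H)\<^sup>\<bottom>, H\<rangle>\<close>, Cauchy--Schwarz lets the gradient term absorb \<open>(k\<^sub>\<epsilon>')\<^sup>2\<close>, so that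
  \<open>\<partial>\<^sub>t k\<^sub>\<epsilon> \<le> k\<^sub>\<epsilon>'' + k\<^sup>4 / k\<^sub>\<epsilon> + C\<^sub>1 (k + 1)\<close>. The integral of \<open>k\<^sub>\<epsilon>''\<close> vanishes and the term \<open>k\<^sup>4 / k\<^sub>\<epsilon>\<close> is
  compensated by the shrinking of \<open>ds\<close>, so \<open>\<integral> k\<^sub>\<epsilon> ds\<close> satisfies a differential inequality. By the mean
  value theorem it bounds difference quotients, and these bounds survive \<open>\<epsilon> \<rightarrow> 0\<close>.
\<close>

section \<open>Calculus of \<open>Ck_on\<close>\<close>

text \<open>The flow lives on a closed time interval, so derivatives are taken within
  \<open>strip T\<close> or a relatively open part of it and become one-sided at the times 0 and T.
  Uniqueness of derivatives, symmetry of mixed partials and differentiation under the integral are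
  therefore needed up to the boundary. The analysis runs on the squares \<open>P = |X|^2\<close> and
  \<open>K = k^2\<close>. Square roots are differentiated only where their argument is positive;
  \<open>k\<close> itself is never differentiated. The moving metric is treated as one fixed metric
  on space-time. A single product rule along curves then yields both the Ricci term in the time
  derivative of \<open>|X|^2\<close> and the space derivative of \<open>k^2\<close>. After that only
  inequalities between the scalar functions \<open>P\<close>, \<open>K\<close> and \<open>N\<close>
  remain, and the rest is analysis on a strip. The constant \<open>C1 = Chat / 2\<close> comes from
  the factor in \<open>d (sqrt K) = dK / (2 * sqrt K)\<close>: formally
  \<open>Chat * (k^2 + k) / (2 * k) = C1 * (k + 1)\<close>, whose integral is \<open>C1\<close>
  times the total curvature plus the length.\<close>

definition thick :: "'a::euclidean_space set \<Rightarrow> bool" where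
  "thick S \<longleftrightarrow> (\<forall>x\<in>S. \<forall>i\<in>Basis. \<forall>e>0. \<exists>d. 0 < \<bar>d\<bar> \<and> \<bar>d\<bar> < e \<and> x + d *\<^sub>R i \<in> S)"

text \<open>\<open>thick\<close> is designed for this lemma: arbitrarily small nonzero increments
  along every axis are what forces a derivative within \<open>S\<close> to be unique. Open sets,
  closed nondegenerate intervals, their products and relatively open subsets all qualify.\<close>

lemma thick_has_derivative_unique:
  fixes f :: "'a::euclidean_space \<Rightarrow> 'b::real_normed_vector"
  assumes "thick S" "x \<in> S"
    and "(f has_derivative f') (at x within S)" "(f has_derivative f'') (at x within S)"
  shows "f' = f''"
  using frechet_derivative_unique_within[OF assms(3,4)] assms(1,2) by (auto simp: thick_def)

lemma thick_frechet_derivative: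
  fixes f :: "'a::euclidean_space \<Rightarrow> 'b::real_normed_vector"
  assumes "thick S" "x \<in> S" "(f has_derivative f') (at x within S)"
  shows "frechet_derivative f (at x within S) = f'"
  using thick_has_derivative_unique[OF assms(1,2) _ assms(3)] assms(3)
  by (metis differentiableI frechet_derivative_works)

lemma thick_openin:
  fixes S :: "'a::euclidean_space set"
  assumes "thick S" "openin (top_of_set S) S'"
  shows "thick S'"
  unfolding thick_def
proof (intro ballI allI impI)
  fix x i :: 'a and e :: real assume x: "x \<in> S'" and i: "i \<in> Basis" and "0 < e"
  obtain r where r: "r > 0" "\<And>y. y \<in> S \<Longrightarrow> dist y x < r \<Longrightarrow> y \<in> S'"
    using assms(2) x by (metis openin_euclidean_subtopology_iff)
  have "x \<in> S" using assms(2) x openin_imp_subset by blast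
  then obtain d where d: "0 < \<bar>d\<bar>" "\<bar>d\<bar> < min e r" "x + d *\<^sub>R i \<in> S"
    using assms(1) i \<open>0 < e\<close> r(1) unfolding thick_def by (meson min_less_iff_conj)
  moreover have "x + d *\<^sub>R i \<in> S'" using r(2) d i by (simp add: dist_norm)
  ultimately show "\<exists>d. 0 < \<bar>d\<bar> \<and> \<bar>d\<bar> < e \<and> x + d *\<^sub>R i \<in> S'" by auto
qed

lemma thick_UNIV: "thick UNIV"
  unfolding thick_def
proof (intro ballI allI impI)
  fix x i :: 'a and e :: real assume "0 < e"
  then show "\<exists>d. 0 < \<bar>d\<bar> \<and> \<bar>d\<bar> < e \<and> x + d *\<^sub>R i \<in> UNIV"
    by (intro exI[of _ "e / 2"]) auto
qed

lemma thick_open: "open S \<Longrightarrow> thick S"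
  by (rule thick_openin[OF thick_UNIV]) (simp add: open_openin[symmetric])

lemma thick_Times:
  fixes A :: "'a::euclidean_space set" and B :: "'b::euclidean_space set"
  assumes "thick A" "thick B"
  shows "thick (A \<times> B)"
  unfolding thick_def
proof (intro ballI allI impI)
  fix z i :: "'a \<times> 'b" and e :: real assume z: "z \<in> A \<times> B" and i: "i \<in> Basis" and e: "0 < e"
  consider j where "i = (j, 0)" "j \<in> Basis" | j where "i = (0, j)" "j \<in> Basis"
    using i by (auto simp: Basis_prod_def)
  then show "\<exists>d. 0 < \<bar>d\<bar> \<and> \<bar>d\<bar> < e \<and> z + d *\<^sub>R i \<in> A \<times> B"
  proof cases
    case 1
    then obtain d where "0 < \<bar>d\<bar>" "\<bar>d\<bar> < e" "fst z + d *\<^sub>R j \<in> A"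
      using assms(1)[unfolded thick_def, rule_format, of "fst z" j e] z e by auto
    then show ?thesis using 1 z by (intro exI[of _ d]) auto
  next
    case 2
    then obtain d where "0 < \<bar>d\<bar>" "\<bar>d\<bar> < e" "snd z + d *\<^sub>R j \<in> B"
      using assms(2)[unfolded thick_def, rule_format, of "snd z" j e] z e by auto
    then show ?thesis using 2 z by (intro exI[of _ d]) auto
  qed
qed

lemma thick_Icc:
  assumes "(a::real) < b"
  shows "thick {a..b}"
  unfolding thick_def
proof (intro ballI allI impI)
  fix x i e :: real assume x: "x \<in> {a..b}" and "i \<in> Basis" and "0 < e"
  then have "i = 1" by simp
  show "\<exists>d. 0 < \<bar>d\<bar> \<and> \<bar>d\<bar> < e \<and> x + d *\<^sub>R i \<in> {a..b}"
  proof (cases "x < b")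
    case True
    show ?thesis
      by (rule exI[of _ "min (b - x) e / 2"]) (use True x \<open>0 < e\<close> \<open>i = 1\<close> in \<open>auto simp: min_def field_simps\<close>)
  next
    case False
    show ?thesis
      by (rule exI[of _ "- (min (b - a) e / 2)"])
        (use False x \<open>0 < e\<close> \<open>i = 1\<close> assms in \<open>auto simp: min_def field_simps\<close>)
  qed
qed

lemma at_within_openin:
  assumes "openin (top_of_set S) S'" "x \<in> S'"
  shows "at x within S' = at x within S"
proof -
  obtain U where "open U" "S' = S \<inter> U" using assms(1) by (metis openin_open)
  then show ?thesis using assms(2) by (intro at_within_nhd[where S = U]) auto
qed

text \<open>\<open>frechet_derivative\<close> is a choice, but the predicate it chooses from depends
  only on the values on \<open>S\<close>. The equality thus holds even where no derivative
  exists.\<close>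

lemma frechet_derivative_cong_on:
  assumes "\<And>x. x \<in> S \<Longrightarrow> f x = g x" "x \<in> S"
  shows "frechet_derivative f (at x within S) = frechet_derivative g (at x within S)"
proof -
  have "(f has_derivative f') (at x within S) \<longleftrightarrow> (g has_derivative f') (at x within S)" for f'
    using has_derivative_transform[of x S f g f'] has_derivative_transform[of x S g f f'] assms by auto
  then show ?thesis unfolding frechet_derivative_def by simp
qed

lemma Ck_on_cong:
  assumes "\<And>x. x \<in> S \<Longrightarrow> f x = g x"
  shows "Ck_on n S f \<longleftrightarrow> Ck_on n S g"
  using assms
proof (induction n arbitrary: f g)
  case 0
  then show ?case by (simp cong: continuous_on_cong)
next
  case (Suc n)
  have "Ck_on n S (\<lambda>x. frechet_derivative f (at x within S) v) \<longleftrightarrow>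
        Ck_on n S (\<lambda>x. frechet_derivative g (at x within S) v)" for v
    using frechet_derivative_cong_on[of S f g] Suc.prems by (intro Suc.IH) metis
  moreover have "f differentiable_on S \<longleftrightarrow> g differentiable_on S"
    unfolding differentiable_on_def differentiable_def
    using has_derivative_transform[of _ S f g] has_derivative_transform[of _ S g f] Suc.prems by metis
  ultimately show ?case by simp
qed

text \<open>Thickness identifies the chosen derivative with any derivative computed by hand, so
  smoothness can be proved from explicit formulas.\<close>

lemma Ck_on_SucI:
  fixes f :: "'a::euclidean_space \<Rightarrow> 'b::real_normed_vector"
  assumes "thick S" "\<And>x. x \<in> S \<Longrightarrow> (f has_derivative f' x) (at x within S)"
    and "\<And>v. Ck_on n S (\<lambda>x. f' x v)"
  shows "Ck_on (Suc n) S f"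
proof -
  have "Ck_on n S (\<lambda>x. frechet_derivative f (at x within S) v)" for v
    using assms(3)[of v] thick_frechet_derivative[OF assms(1) _ assms(2)]
    by (subst Ck_on_cong[where g = "\<lambda>x. f' x v"]) auto
  moreover have "f differentiable_on S"
    using assms(2) by (auto simp: differentiable_on_def differentiable_def)
  ultimately show ?thesis by simp
qed

lemma Ck_on_has_derivative:
  assumes "Ck_on (Suc n) S f" "x \<in> S"
  shows "(f has_derivative frechet_derivative f (at x within S)) (at x within S)"
  using assms by (auto simp: differentiable_on_def frechet_derivative_works)

lemma Ck_on_Suc_imp: "Ck_on (Suc n) S f \<Longrightarrow> Ck_on n S f"
proof (induction n arbitrary: f)
  case 0
  then show ?case by (simp add: differentiable_imp_continuous_on)
next
  case (Suc n)
  then show ?case by (simp only: Ck_on.simps(2)) blast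
qed

lemma Ck_on_const: "thick (S :: 'a::euclidean_space set) \<Longrightarrow> Ck_on n S (\<lambda>x. c)"
proof (induction n arbitrary: c)
  case (Suc n)
  then show ?case by (intro Ck_on_SucI[where f' = "\<lambda>x v. 0"]) auto
qed simp

lemma Ck_on_id: "thick (S :: 'a::euclidean_space set) \<Longrightarrow> Ck_on n S (\<lambda>x. x)"
proof (cases n)
  case (Suc m)
  assume S: "thick S"
  show ?thesis unfolding Suc
    by (rule Ck_on_SucI[OF S has_derivative_ident Ck_on_const[OF S]])
qed simp

lemma Ck_on_bounded_linear:
  fixes f :: "'a::euclidean_space \<Rightarrow> 'b::real_normed_vector"
  assumes "thick S" "bounded_linear L"
  shows "Ck_on n S f \<Longrightarrow> Ck_on n S (\<lambda>x. L (f x))"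
proof (induction n arbitrary: f)
  case 0
  then show ?case using assms(2) by (simp add: bounded_linear.continuous_on)
next
  case (Suc n)
  show ?case
    by (rule Ck_on_SucI[OF assms(1) bounded_linear.has_derivative[OF assms(2) Ck_on_has_derivative[OF Suc.prems]]])
      (use Suc in auto)
qed

lemma Ck_on_add:
  fixes f g :: "'a::euclidean_space \<Rightarrow> 'b::real_normed_vector"
  assumes "thick S"
  shows "Ck_on n S f \<Longrightarrow> Ck_on n S g \<Longrightarrow> Ck_on n S (\<lambda>x. f x + g x)"
proof (induction n arbitrary: f g)
  case 0
  then show ?case by (simp add: continuous_on_add)
next
  case (Suc n)
  show ?case
    by (rule Ck_on_SucI[OF assms(1) has_derivative_add[OF
          Ck_on_has_derivative[OF Suc.prems(1)] Ck_on_has_derivative[OF Suc.prems(2)]]])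
      (use Suc in auto)
qed

lemma Ck_on_sum:
  fixes f :: "'i \<Rightarrow> 'a::euclidean_space \<Rightarrow> 'b::real_normed_vector"
  assumes "thick S" "\<And>i. i \<in> I \<Longrightarrow> Ck_on n S (f i)"
  shows "Ck_on n S (\<lambda>x. \<Sum>i\<in>I. f i x)"
  using assms(2)
  by (induction I rule: infinite_finite_induct) (auto simp: Ck_on_const Ck_on_add assms(1))

lemma Ck_on_mult:
  fixes f g :: "'a::euclidean_space \<Rightarrow> real"
  assumes "thick S"
  shows "Ck_on n S f \<Longrightarrow> Ck_on n S g \<Longrightarrow> Ck_on n S (\<lambda>x. f x * g x)"
proof (induction n arbitrary: f g)
  case 0
  then show ?case by (simp add: continuous_on_mult)
next
  case (Suc n)
  show ?case
    by (rule Ck_on_SucI[OF assms(1) has_derivative_mult[OF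
          Ck_on_has_derivative[OF Suc.prems(1)] Ck_on_has_derivative[OF Suc.prems(2)]]])
      (use Suc in \<open>auto intro!: Ck_on_add[OF assms] Suc.IH simp: Ck_on_Suc_imp simp del: Ck_on.simps(2), auto\<close>)
qed

text \<open>\<open>Ck_on\<close> controls derivatives only in a fixed direction, whereas the chain
  rule evaluates the derivative of \<open>f\<close> in the varying direction \<open>?H z v\<close>.
  Expanding this direction in \<open>Basis\<close> gives a sum of products of functions with fixed
  directions, to which induction applies.\<close>

lemma Ck_on_compose:
  fixes f :: "'a::euclidean_space \<Rightarrow> real" and h :: "'c::euclidean_space \<Rightarrow> 'a"
  assumes "thick S" "h ` S \<subseteq> S'"
  shows "Ck_on n S' f \<Longrightarrow> Ck_on n S h \<Longrightarrow> Ck_on n S (\<lambda>x. f (h x))"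
proof (induction n arbitrary: f)
  case 0
  then show ?case using assms(2) by (auto intro: continuous_on_compose2)
next
  case (Suc n)
  let ?F = "\<lambda>q. frechet_derivative f (at q within S')"
  let ?H = "\<lambda>z. frechet_derivative h (at z within S)"
  show ?case
  proof (rule Ck_on_SucI[OF assms(1)])
    fix z assume z: "z \<in> S"
    have F: "(f has_derivative ?F (h z)) (at (h z) within S')"
      using Ck_on_has_derivative[OF Suc.prems(1)] assms(2) z by blast
    have "((\<lambda>x. f (h x)) has_derivative (\<lambda>v. ?F (h z) (?H z v))) (at z within S)"
      using has_derivative_in_compose2[of S' f ?F h S z] assms(2) z F
        Ck_on_has_derivative[OF Suc.prems(1)] Ck_on_has_derivative[OF Suc.prems(2) z] by blast
    moreover have "?F (h z) (?H z v) = (\<Sum>b\<in>Basis. (?H z v \<bullet> b) * ?F (h z) b)" for v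
      using F[THEN has_derivative_linear] by (subst euclidean_representation[of "?H z v", symmetric])
        (simp add: linear_sum linear_cmul)
    ultimately show "((\<lambda>x. f (h x)) has_derivative (\<lambda>v. \<Sum>b\<in>Basis. (?H z v \<bullet> b) * ?F (h z) b))
        (at z within S)" by simp
  next
    fix v
    show "Ck_on n S (\<lambda>z. \<Sum>b\<in>Basis. (?H z v \<bullet> b) * ?F (h z) b)"
    proof (intro Ck_on_sum Ck_on_mult assms(1))
      fix b :: 'a
      have "Ck_on n S (\<lambda>z. ?H z v)" using Suc.prems(2) by simp
      then show "Ck_on n S (\<lambda>z. ?H z v \<bullet> b)"
        by (rule Ck_on_bounded_linear[OF assms(1) bounded_linear_inner_left])
      show "Ck_on n S (\<lambda>z. ?F (h z) b)"
        using Suc.prems by (intro Suc.IH Ck_on_Suc_imp[OF Suc.prems(2)]) simp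
    qed
  qed
qed

text \<open>Derivatives within \<open>S\<close> and within a relatively open \<open>S'\<close>
  coincide, so smoothness is local. This serves functions on the strip that are given by a different
  chart formula near each point.\<close>

lemma Ck_on_glue:
  assumes "\<And>p. p \<in> S \<Longrightarrow> \<exists>S'. p \<in> S' \<and> openin (top_of_set S) S' \<and> Ck_on n S' f"
  shows "Ck_on n S f"
  using assms
proof (induction n arbitrary: f)
  case 0
  show ?case unfolding Ck_on.simps continuous_on_eq_continuous_within
  proof
    fix p assume "p \<in> S"
    then obtain S' where "p \<in> S'" "openin (top_of_set S) S'" "continuous_on S' f"
      using 0 by auto
    then show "continuous (at p within S) f"
      using at_within_openin[of S S' p] by (auto simp: continuous_on_eq_continuous_within)
  qed
next
  case (Suc n)
  have "f differentiable (at p within S)" if p: "p \<in> S" for p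
  proof -
    obtain S' where S': "p \<in> S'" "openin (top_of_set S) S'" "Ck_on (Suc n) S' f"
      using Suc.prems[OF p] by (elim exE conjE)
    then have "f differentiable (at p within S')" by (simp add: differentiable_on_def)
    then show ?thesis by (simp only: at_within_openin[OF S'(2,1)])
  qed
  moreover have "Ck_on n S (\<lambda>x. frechet_derivative f (at x within S) v)" for v
  proof (rule Suc.IH)
    fix p assume p: "p \<in> S"
    obtain S' where S': "p \<in> S'" "openin (top_of_set S) S'" "Ck_on (Suc n) S' f"
      using Suc.prems[OF p] by (elim exE conjE)
    have "Ck_on n S' (\<lambda>x. frechet_derivative f (at x within S) v) \<longleftrightarrow>
          Ck_on n S' (\<lambda>x. frechet_derivative f (at x within S') v)"
      by (rule Ck_on_cong) (simp add: at_within_openin[OF S'(2)])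
    then show "\<exists>S'. p \<in> S' \<and> openin (top_of_set S) S' \<and> Ck_on n S' (\<lambda>x. frechet_derivative f (at x within S) v)"
      using S' by auto
  qed
  ultimately show ?case by (simp add: differentiable_on_def)
qed

section \<open>Partial derivatives on the closed space-time strip\<close>

lemma partial_derivatives:
  fixes f :: "real \<times> real \<Rightarrow> 'b::real_normed_vector"
  assumes "(f has_derivative F) (at (x, s) within S)"
  shows "((\<lambda>y. f (y, s)) has_vector_derivative F (1, 0)) (at x within {y. (y, s) \<in> S})"
    and "((\<lambda>r. f (x, r)) has_vector_derivative F (0, 1)) (at s within {r. (x, r) \<in> S})"
proof -
  have F: "F (r *\<^sub>R w) = r *\<^sub>R F w" for r w
    using linear_cmul[OF has_derivative_linear[OF assms]] .
  have sub: "(f has_derivative F) (at (x, s) within (\<lambda>y. (y, s)) ` {y. (y, s) \<in> S})"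
      "(f has_derivative F) (at (x, s) within (\<lambda>r. (x, r)) ` {r. (x, r) \<in> S})"
    by (rule has_derivative_subset[OF assms]; auto)+
  have 1: "((\<lambda>y. (y, s)) has_derivative (\<lambda>h. (h, 0))) (at x within {y. (y, s) \<in> S})"
    by (rule has_derivative_Pair[OF has_derivative_ident has_derivative_const])
  have 2: "((\<lambda>r. (x, r)) has_derivative (\<lambda>h. (0, h))) (at s within {r. (x, r) \<in> S})"
    by (rule has_derivative_Pair[OF has_derivative_const has_derivative_ident])
  have "((\<lambda>y. f (y, s)) has_derivative (\<lambda>h. F (h, 0))) (at x within {y. (y, s) \<in> S})"
    using has_derivative_in_compose[OF 1 sub(1)] .
  then show "((\<lambda>y. f (y, s)) has_vector_derivative F (1, 0)) (at x within {y. (y, s) \<in> S})"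
    unfolding has_vector_derivative_def using F[of _ "(1, 0)", symmetric] by simp
  have "((\<lambda>r. f (x, r)) has_derivative (\<lambda>h. F (0, h))) (at s within {r. (x, r) \<in> S})"
    using has_derivative_in_compose[OF 2 sub(2)] .
  then show "((\<lambda>r. f (x, r)) has_vector_derivative F (0, 1)) (at s within {r. (x, r) \<in> S})"
    unfolding has_vector_derivative_def using F[of _ "(0, 1)", symmetric] by simp
qed

abbreviation strip :: "real \<Rightarrow> (real \<times> real) set" where
  "strip T \<equiv> UNIV \<times> {0..T}"

abbreviation dx :: "real \<Rightarrow> (real \<times> real \<Rightarrow> real) \<Rightarrow> real \<times> real \<Rightarrow> real" where
  "dx T f z \<equiv> frechet_derivative f (at z within strip T) (1, 0)"

abbreviation dt :: "real \<Rightarrow> (real \<times> real \<Rightarrow> real) \<Rightarrow> real \<times> real \<Rightarrow> real" where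
  "dt T f z \<equiv> frechet_derivative f (at z within strip T) (0, 1)"

lemma thick_strip: "0 < T \<Longrightarrow> thick (strip T)"
  by (intro thick_Times thick_UNIV thick_Icc)

lemma dx_dt:
  fixes f :: "real \<times> real \<Rightarrow> real"
  assumes "Ck_on (Suc n) (strip T) f" "s \<in> {0..T}"
  shows "((\<lambda>y. f (y, s)) has_real_derivative dx T f (x, s)) (at x)"
    and "((\<lambda>r. f (x, r)) has_real_derivative dt T f (x, s)) (at s within {0..T})"
proof -
  have "{y. (y, s) \<in> strip T} = UNIV" "{r. (x, r) \<in> strip T} = {0..T}" using assms(2) by auto
  then show "((\<lambda>y. f (y, s)) has_real_derivative dx T f (x, s)) (at x)"
    and "((\<lambda>r. f (x, r)) has_real_derivative dt T f (x, s)) (at s within {0..T})"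
    using partial_derivatives[OF Ck_on_has_derivative[OF assms(1), of "(x, s)"]] assms(2)
    by (auto simp: has_real_derivative_iff_has_vector_derivative)
qed

lemma DERIV_unique_Icc:
  fixes f :: "real \<Rightarrow> real"
  assumes "a < b" "x \<in> {a..b}"
    and "(f has_real_derivative d) (at x within {a..b})" "(f has_real_derivative d') (at x within {a..b})"
  shows "d = d'"
  using thick_has_derivative_unique[OF thick_Icc[OF assms(1)] assms(2)
      assms(3,4)[unfolded has_field_derivative_def]]
  by (metis mult.right_neutral)

lemma DERIV_sqrt_comp:
  assumes "(f has_real_derivative d) (at x within S)" "0 < f x"
  shows "((\<lambda>y. sqrt (f y)) has_real_derivative inverse (sqrt (f x)) / 2 * d) (at x within S)"
  using DERIV_chain2[where f = sqrt and g = f, OF DERIV_real_sqrt[OF assms(2)] assms(1)] .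

lemma Ck_on_partial:
  assumes "Ck_on (Suc n) S f"
  shows "Ck_on n S (\<lambda>z. frechet_derivative f (at z within S) v)"
  using assms by simp

lemma Ck_on_continuous:
  assumes "Ck_on n S f"
  shows "continuous_on S f"
  using assms by (cases n) (auto intro: differentiable_imp_continuous_on)

text \<open>One derivative suffices: the root is taken of \<open>|X|^2\<close> and of
  \<open>k^2 + e^2\<close>, and neither root is ever differentiated twice.\<close>

lemma Ck_on_1_sqrt:
  fixes f :: "'a::euclidean_space \<Rightarrow> real"
  assumes "thick S" "Ck_on (Suc 0) S f" "\<And>z. z \<in> S \<Longrightarrow> f z > 0"
  shows "Ck_on (Suc 0) S (\<lambda>z. sqrt (f z))"
proof (rule Ck_on_compose[OF assms(1), where S' = "{0<..}" and f = sqrt and h = f])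
  show "f ` S \<subseteq> {0<..}" using assms(3) by auto
  show "Ck_on (Suc 0) {0<..} sqrt"
  proof (rule Ck_on_SucI[where f' = "\<lambda>x v. inverse (sqrt x) / 2 * v"])
    show "thick {0::real<..}" by (simp add: thick_open)
    show "(sqrt has_derivative (\<lambda>v. inverse (sqrt x) / 2 * v)) (at x within {0<..})"
      if "x \<in> {0<..}" for x
      using that
      by (intro has_derivative_at_withinI[OF DERIV_real_sqrt[unfolded has_field_derivative_def]]) simp
    show "Ck_on 0 {0<..} (\<lambda>x. inverse (sqrt x) / 2 * v)" for v :: real
      by (auto intro!: continuous_intros)
  qed
qed (rule assms(2))

lemma integral_strip_derivative:
  fixes f :: "real \<times> real \<Rightarrow> real"
  assumes "Ck_on (Suc 0) (strip T) f" "s \<in> {0..T}"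
  shows "((\<lambda>r. integral {a..b} (\<lambda>x. f (x, r))) has_real_derivative
      integral {a..b} (\<lambda>x. dt T f (x, s))) (at s within {0..T})"
proof -
  have "((\<lambda>r. integral (cbox a b) (\<lambda>x. f (x, r))) has_real_derivative
      integral (cbox a b) (\<lambda>x. dt T f (x, s))) (at s within {0..T})"
  proof (rule leibniz_rule_field_derivative)
    show "((\<lambda>r. f (x, r)) has_real_derivative dt T f (x, r)) (at r within {0..T})"
      if "r \<in> {0..T}" for x r using dx_dt(2)[OF assms(1) that] .
    have "continuous_on (strip T) f" using Ck_on_continuous[OF assms(1)] .
    then have "continuous_on (cbox a b) (\<lambda>x. f (x, r))" if "r \<in> {0..T}" for r
      by (rule continuous_on_compose2) (use that in \<open>auto intro!: continuous_intros\<close>)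
    then show "(\<lambda>x. f (x, r)) integrable_on cbox a b" if "r \<in> {0..T}" for r
      using that by (intro integrable_continuous)
    have "continuous_on (strip T) (dt T f)" using Ck_on_partial[OF assms(1)] by simp
    then have "continuous_on ({0..T} \<times> cbox a b) (\<lambda>z. dt T f (snd z, fst z))"
      by (rule continuous_on_compose2) (auto intro!: continuous_intros)
    then show "continuous_on ({0..T} \<times> cbox a b) (\<lambda>(r, x). dt T f (x, r))"
      by (simp add: split_def)
  qed (use assms in auto)
  then show ?thesis by simp
qed

lemma continuous_on_strip_slice:
  assumes "continuous_on (strip T) f" "s \<in> {0..T}"
  shows "continuous_on A (\<lambda>x. f (x, s))"
  using assms(1) by (rule continuous_on_compose2) (use assms(2) in \<open>auto intro!: continuous_intros\<close>)

text \<open>Integrating in \<open>t\<close> and differentiating under the integral also covers the boundary times.\<close>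

lemma mixed_partials:
  fixes f :: "real \<times> real \<Rightarrow> 'a::euclidean_space"
  assumes "0 < T" "openin (top_of_set (strip T)) S" "Ck_on (Suc (Suc 0)) S f" "z \<in> S"
  defines "fx \<equiv> \<lambda>z. frechet_derivative f (at z within S) (1, 0)"
    and "ft \<equiv> \<lambda>z. frechet_derivative f (at z within S) (0, 1)"
  shows "frechet_derivative fx (at z within S) (0, 1) = frechet_derivative ft (at z within S) (1, 0)"
proof -
  obtain x s where z: "z = (x, s)" by fastforce
  have S: "S \<subseteq> strip T" using assms(2) openin_imp_subset by blast
  then have s: "s \<in> {0..T}" using assms(4) z by auto
  obtain e where e: "e > 0" "\<And>w. w \<in> strip T \<Longrightarrow> dist w z < e \<Longrightarrow> w \<in> S"
    using assms(2,4) by (metis openin_euclidean_subtopology_iff)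
  \<comment> \<open>A closed rectangle around \<open>z\<close> inside \<open>S\<close> is needed.
    Its points have distance at most \<open>2 * d = e / 2\<close> from \<open>z\<close>, and
    clipping \<open>a\<close>, \<open>b\<close> to the time interval keeps the rectangle in the
    strip also when \<open>s\<close> is 0 or T.\<close>
  define d where "d = e / 4"
  define a b where "a = max 0 (s - d)" and "b = min T (s + d)"
  have d: "0 < d" using e d_def by simp
  have ab: "a < b" "s \<in> {a..b}" "{a..b} \<subseteq> {0..T}" using d s assms(1) by (auto simp: a_def b_def)
  let ?U = "{x - d..x + d}"
  have rect: "(y, r) \<in> S" if "y \<in> ?U" "r \<in> {a..b}" for y r
  proof (rule e(2))
    show "(y, r) \<in> strip T" using that ab by auto
    have "dist y x \<le> d" "dist r s \<le> d" using that by (auto simp: dist_real_def a_def b_def)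
    then have "dist (y, r) (x, s) \<le> d + d"
      unfolding dist_Pair_Pair
      by (intro order_trans[OF sqrt_sum_squares_le_sum]) auto
    then show "dist (y, r) z < e" using e(1) by (simp add: z d_def)
  qed
  have f1: "Ck_on (Suc 0) S f" and fx1: "Ck_on (Suc 0) S fx" and ft1: "Ck_on (Suc 0) S ft"
    unfolding fx_def ft_def using Ck_on_Suc_imp[OF assms(3)] Ck_on_partial[OF assms(3)] by blast+
  define ftx where "ftx z = frechet_derivative ft (at z within S) (1, 0)" for z
  have px: "((\<lambda>y. h (y, r)) has_vector_derivative frechet_derivative h (at (y, r) within S) (1, 0)) (at y within ?U)"
    if h: "Ck_on (Suc 0) S h" and "y \<in> ?U" "r \<in> {a..b}" for h :: "real \<times> real \<Rightarrow> 'a" and y r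
    by (rule has_vector_derivative_within_subset[OF
          partial_derivatives(1)[OF Ck_on_has_derivative[OF h rect[OF that(2,3)]]]])
      (use rect that in auto)
  have pt: "((\<lambda>r. h (y, r)) has_vector_derivative frechet_derivative h (at (y, r) within S) (0, 1)) (at r within {a..b})"
    if h: "Ck_on (Suc 0) S h" and "y \<in> ?U" "r \<in> {a..b}" for h :: "real \<times> real \<Rightarrow> 'a" and y r
    by (rule has_vector_derivative_within_subset[OF
          partial_derivatives(2)[OF Ck_on_has_derivative[OF h rect[OF that(2,3)]]]])
      (use rect that in auto)
  have cont_ft: "continuous_on S ft" using Ck_on_continuous[OF ft1] .
  have cont_ftx: "continuous_on S ftx" unfolding ftx_def using Ck_on_partial[OF ft1] by simp
  have x: "x \<in> ?U" using d by simp
  \<comment> \<open>Writing \<open>f (y, r)\<close> as \<open>f (y, a)\<close> plus the integral of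
    \<open>ft\<close> and differentiating in \<open>y\<close> under the integral represents
    \<open>fx\<close> by an integral of the continuous function \<open>ftx\<close>. Its derivative
    in \<open>r\<close> is then read off.\<close>
  have fx_int: "fx (x, r) = fx (x, a) + integral {a..r} (\<lambda>\<tau>. ftx (x, \<tau>))" if r: "r \<in> {a..b}" for r
  proof -
    have sub: "{a..r} \<subseteq> {a..b}" using r by auto
    have FTC: "f (y, r) = f (y, a) + integral {a..r} (\<lambda>\<tau>. ft (y, \<tau>))" if y: "y \<in> ?U" for y
    proof -
      have "((\<lambda>\<tau>. ft (y, \<tau>)) has_integral f (y, r) - f (y, a)) {a..r}"
      proof (rule fundamental_theorem_of_calculus)
        fix \<tau> assume "\<tau> \<in> {a..r}"
        then show "((\<lambda>r. f (y, r)) has_vector_derivative ft (y, \<tau>)) (at \<tau> within {a..r})"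
          unfolding ft_def using has_vector_derivative_within_subset[OF pt[OF f1 y] sub] sub by blast
      qed (use r in auto)
      from integral_unique[OF this] show ?thesis by simp
    qed
    have "((\<lambda>y. integral (cbox a r) (\<lambda>\<tau>. ft (y, \<tau>))) has_vector_derivative
        integral (cbox a r) (\<lambda>\<tau>. ftx (x, \<tau>))) (at x within ?U)"
    proof (rule leibniz_rule_vector_derivative)
      show "((\<lambda>y. ft (y, \<tau>)) has_vector_derivative ftx (y, \<tau>)) (at y within ?U)"
        if "y \<in> ?U" "\<tau> \<in> cbox a r" for y \<tau>
        unfolding ftx_def using px[OF ft1 that(1)] that(2) sub by auto
      show "(\<lambda>\<tau>. ft (y, \<tau>)) integrable_on cbox a r" if "y \<in> ?U" for y
        by (intro integrable_continuous continuous_on_compose2[OF cont_ft] continuous_intros)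
          (use rect that sub in auto)
      show "continuous_on (?U \<times> cbox a r) (\<lambda>(y, \<tau>). ftx (y, \<tau>))"
        using sub rect by (auto intro!: continuous_on_subset[OF cont_ftx])
    qed (use x in auto)
    then have I: "((\<lambda>y. integral {a..r} (\<lambda>\<tau>. ft (y, \<tau>))) has_vector_derivative
        integral {a..r} (\<lambda>\<tau>. ftx (x, \<tau>))) (at x within ?U)" by simp
    have I: "((\<lambda>y. f (y, a) + integral {a..r} (\<lambda>\<tau>. ft (y, \<tau>))) has_vector_derivative
        fx (x, a) + integral {a..r} (\<lambda>\<tau>. ftx (x, \<tau>))) (at x within ?U)"
      using has_vector_derivative_add[OF px[OF f1 x] I] ab(1) by (simp add: fx_def)
    have 1: "((\<lambda>y. f (y, r)) has_vector_derivative
        fx (x, a) + integral {a..r} (\<lambda>\<tau>. ftx (x, \<tau>))) (at x within ?U)"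
      by (rule has_vector_derivative_transform[OF x _ I]) (rule FTC)
    have 2: "((\<lambda>y. f (y, r)) has_vector_derivative fx (x, r)) (at x within ?U)"
      unfolding fx_def by (rule px[OF f1 x r])
    show ?thesis
      using vector_derivative_unique_within_closed_interval[of "x - d" "x + d", OF _ _ 2[unfolded box_real[symmetric]] 1[unfolded box_real[symmetric]]]
        d by simp
  qed
  have "((\<lambda>r. integral {a..r} (\<lambda>\<tau>. ftx (x, \<tau>))) has_vector_derivative ftx (x, s)) (at s within {a..b})"
    by (rule integral_has_vector_derivative[OF _ ab(2)])
      (intro continuous_on_compose2[OF cont_ftx] continuous_intros, use rect x in auto)
  then have I: "((\<lambda>r. fx (x, a) + integral {a..r} (\<lambda>\<tau>. ftx (x, \<tau>))) has_vector_derivative ftx (x, s)) (at s within {a..b})"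
    by (simp add: has_vector_derivative_const has_vector_derivative_add[of _ 0, simplified])
  have 1: "((\<lambda>r. fx (x, r)) has_vector_derivative ftx (x, s)) (at s within {a..b})"
    by (rule has_vector_derivative_transform[OF ab(2) _ I]) (rule fx_int)
  have "frechet_derivative fx (at (x, s) within S) (0, 1) = ftx (x, s)"
    using vector_derivative_unique_within_closed_interval[of a b, OF _ _ pt[OF fx1 x ab(2), unfolded box_real[symmetric]] 1[unfolded box_real[symmetric]]]
      ab by simp
  then show ?thesis by (simp add: ftx_def z)
qed

section \<open>Inner products and metric fields\<close>

lemma inner_formD:
  assumes "inner_form B"
  shows "bilinear B" "B u v = B v u" "u \<noteq> 0 \<Longrightarrow> B u u > 0" "B u u \<ge> 0"
proof -
  show *: "bilinear B" "B u v = B v u" "u \<noteq> 0 \<Longrightarrow> B u u > 0"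
    using assms by (auto simp: inner_form_def)
  show "B u u \<ge> 0"
    using *(3) bilinear_lzero[OF *(1)] by (cases "u = 0") (auto simp: less_imp_le)
qed

lemma bilinear_sum_left:
  fixes B :: "'a::real_vector \<Rightarrow> 'b::real_vector \<Rightarrow> real"
  assumes "bilinear B"
  shows "B (\<Sum>i\<in>I. a i *\<^sub>R e i) y = (\<Sum>i\<in>I. a i * B (e i) y)"
proof -
  have lin: "linear (\<lambda>x. B x y)" using assms by (simp add: bilinear_def)
  show ?thesis
    using linear_sum[OF lin, of "\<lambda>i. a i *\<^sub>R e i" I] by (simp add: bilinear_lmul[OF assms])
qed

lemma bilinear_sum_right:
  fixes B :: "'a::real_vector \<Rightarrow> 'b::real_vector \<Rightarrow> real"
  assumes "bilinear B"
  shows "B x (\<Sum>i\<in>I. a i *\<^sub>R e i) = (\<Sum>i\<in>I. a i * B x (e i))"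
proof -
  have lin: "linear (B x)" using assms by (simp add: bilinear_def)
  show ?thesis
    using linear_sum[OF lin, of "\<lambda>i. a i *\<^sub>R e i" I] by (simp add: bilinear_rmul[OF assms])
qed

lemma bilinear_sum_expand:
  fixes B :: "'a::real_vector \<Rightarrow> 'a \<Rightarrow> real"
  assumes "bilinear B"
  shows "B (\<Sum>i\<in>I. a i *\<^sub>R e i) (\<Sum>j\<in>J. b j *\<^sub>R e' j) = (\<Sum>i\<in>I. \<Sum>j\<in>J. a i * b j * B (e i) (e' j))"
  unfolding bilinear_sum_left[OF assms] unfolding bilinear_sum_right[OF assms]
  by (simp add: sum_distrib_left mult.assoc)

lemma bilinear_Basis_expand:
  fixes B :: "'a::euclidean_space \<Rightarrow> 'a \<Rightarrow> real"
  assumes "bilinear B"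
  shows "B u v = (\<Sum>i\<in>Basis. \<Sum>j\<in>Basis. (u \<bullet> i) * (v \<bullet> j) * B i j)"
  using bilinear_sum_expand[OF assms, of "\<lambda>i. u \<bullet> i" "\<lambda>i. i" Basis "\<lambda>i. v \<bullet> i" "\<lambda>i. i" Basis]
  by (simp add: euclidean_representation)

lemma inner_form_Cauchy_Schwarz:
  assumes "inner_form B"
  shows "(B u v)\<^sup>2 \<le> B u u * B v v"
proof (cases "v = 0")
  case True
  then show ?thesis using bilinear_rzero[OF inner_formD(1)[OF assms]] by simp
next
  case False
  note bil = inner_formD(1)[OF assms]
  \<comment> \<open>This is the component of \<open>u\<close> orthogonal to \<open>v\<close>,
    multiplied by \<open>B v v\<close> to avoid a division.\<close>
  let ?w = "B v v *\<^sub>R u - B u v *\<^sub>R v"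
  have "0 \<le> B ?w ?w" by (rule inner_formD(4)[OF assms])
  also have "B ?w ?w = B v v * (B u u * B v v - (B u v)\<^sup>2)"
    using inner_formD(2)[OF assms, of v u]
    by (simp add: bilinear_lsub[OF bil] bilinear_rsub[OF bil] bilinear_lmul[OF bil]
        bilinear_rmul[OF bil] power2_eq_square algebra_simps)
  finally show ?thesis using inner_formD(3)[OF assms False] by (simp add: zero_le_mult_iff)
qed

lemma inner_form_prod:
  fixes B :: "'a::euclidean_space \<Rightarrow> 'a \<Rightarrow> real"
  assumes "inner_form B"
  shows "inner_form (\<lambda>(u, a) (v, b). B u v + a * b :: real)"
proof -
  note bil = inner_formD(1)[OF assms]
  have "bilinear (\<lambda>(u, a) (v, b). B u v + a * b)"
    unfolding bilinear_def
    by (auto intro!: linearI simp: bilinear_ladd[OF bil] bilinear_radd[OF bil]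
        bilinear_lmul[OF bil] bilinear_rmul[OF bil] algebra_simps)
  moreover have "B u u + a * a > 0" if "(u, a) \<noteq> 0" for u a
    using that inner_formD(3)[OF assms, of u] inner_formD(4)[OF assms, of u]
    by (cases "u = 0")
      (auto simp: zero_prod_def bilinear_lzero[OF bil] not_sum_squares_lt_zero zero_less_mult_iff
        intro: add_pos_nonneg)
  ultimately show ?thesis
    unfolding inner_form_def using inner_formD(2)[OF assms]
    by (auto simp: split_def mult.commute)
qed

text \<open>Gram-Schmidt, by induction on the index set, a subset of \<open>Basis\<close> as
  required by \<open>tensor_norm\<close>. While an index \<open>b\<close> is missing, the vectors
  found so far span a proper subspace; a vector outside it, minus its projection, is nonzero and can
  be normalised.\<close>

lemma inner_form_orthonormal_basis:
  fixes B :: "'a::euclidean_space \<Rightarrow> 'a \<Rightarrow> real"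
  assumes "inner_form B"
  shows "\<exists>e. \<forall>i\<in>Basis. \<forall>j\<in>Basis. B (e i) (e j) = (if i = (j::'a) then 1 else 0)"
proof -
  note bil = inner_formD(1)[OF assms]
  have "\<exists>e. \<forall>i\<in>J. \<forall>j\<in>J. B (e i) (e j) = (if i = j then 1 else 0)"
    if "finite J" "J \<subseteq> Basis" for J :: "'a set"
    using that
  proof (induction J rule: finite_induct)
    case empty
    then show ?case by simp
  next
    case (insert b J)
    then obtain e where e: "\<And>i j. i \<in> J \<Longrightarrow> j \<in> J \<Longrightarrow> B (e i) (e j) = (if i = j then 1 else 0)"
      by auto
    have "card (insert b J) \<le> DIM('a)" using insert.prems by (intro card_mono) auto
    then have "dim (e ` J) < DIM('a)"
      using dim_le_card'[of "e ` J"] card_image_le[of J e] insert.hyps by simp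
    then have "span (e ` J) \<noteq> UNIV" by (metis dim_span dim_UNIV less_irrefl)
    then obtain v where v: "v \<notin> span (e ` J)" by blast
    define w where "w = v - (\<Sum>j\<in>J. B v (e j) *\<^sub>R e j)"
    have "(\<Sum>j\<in>J. B v (e j) *\<^sub>R e j) \<in> span (e ` J)"
      by (intro span_sum span_scale span_base) auto
    then have "w \<noteq> 0" using v w_def by auto
    then have pos: "B w w > 0" by (rule inner_formD(3)[OF assms])
    have orth: "B w (e i) = 0" if "i \<in> J" for i
    proof -
      have "B w (e i) = B v (e i) - (\<Sum>j\<in>J. B v (e j) * B (e j) (e i))"
        unfolding w_def by (simp add: bilinear_lsub[OF bil] bilinear_sum_left[OF bil])
      also have "(\<Sum>j\<in>J. B v (e j) * B (e j) (e i)) = (\<Sum>j\<in>J. if j = i then B v (e i) else 0)"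
        by (rule sum.cong) (auto simp: e that)
      finally show ?thesis using that insert.hyps by simp
    qed
    let ?e = "e(b := w /\<^sub>R sqrt (B w w))"
    have "B (?e i) (?e j) = (if i = j then 1 else 0)" if "i \<in> insert b J" "j \<in> insert b J" for i j
    proof -
      have "inverse (sqrt (B w w)) * (inverse (sqrt (B w w)) * B w w) = 1"
        using pos by (simp add: field_simps)
      then show ?thesis
        using that e orth orth[unfolded inner_formD(2)[OF assms, of w]] insert.hyps(2)
        by (cases "i = b"; cases "j = b") (auto simp: bilinear_lmul[OF bil] bilinear_rmul[OF bil])
    qed
    then show ?case by blast
  qed
  then show ?thesis using finite_Basis by blast
qed

text \<open>Orthonormal vectors are linearly independent, and there are as many of them as the
  dimension, so they span; pairing with \<open>e i\<close> then determines the coefficients.\<close>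

lemma orthonormal_expand:
  fixes B :: "'a::euclidean_space \<Rightarrow> 'a \<Rightarrow> real"
  assumes "inner_form B"
    and e: "\<And>i j. i \<in> Basis \<Longrightarrow> j \<in> Basis \<Longrightarrow> B (e i) (e j) = (if i = (j::'a) then 1 else 0)"
  shows "(\<Sum>i\<in>Basis. B u (e i) *\<^sub>R e i) = u"
proof -
  note bil = inner_formD(1)[OF assms(1)]
  have coef: "B (\<Sum>i\<in>Basis. a i *\<^sub>R e i) (e j) = a j" if "j \<in> Basis" for a j
  proof -
    have "B (\<Sum>i\<in>Basis. a i *\<^sub>R e i) (e j) = (\<Sum>i\<in>Basis. a i * B (e i) (e j))"
      by (rule bilinear_sum_left[OF bil])
    also have "\<dots> = (\<Sum>i\<in>Basis. if i = j then a j else 0)"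
      by (rule sum.cong) (auto simp: e that)
    finally show ?thesis using that by simp
  qed
  have inj: "inj_on e Basis"
    by (rule inj_onI) (metis e zero_neq_one)
  have "independent (e ` Basis)"
  proof (rule independent_if_scalars_zero)
    fix f :: "'a \<Rightarrow> real" and x
    assume s: "(\<Sum>x\<in>e ` Basis. f x *\<^sub>R x) = 0" and "x \<in> e ` Basis"
    then obtain j where j: "j \<in> Basis" "x = e j" by auto
    have "(\<Sum>i\<in>Basis. f (e i) *\<^sub>R e i) = 0" using s by (simp add: sum.reindex[OF inj])
    then show "f x = 0"
      using coef[of j "\<lambda>i. f (e i)"] j bilinear_lzero[OF bil] by simp
  qed simp
  then have "UNIV \<subseteq> span (e ` Basis)"
    by (intro card_ge_dim_independent) (auto simp: card_image[OF inj])
  then obtain a where "u = (\<Sum>x\<in>e ` Basis. a x *\<^sub>R x)"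
    using span_finite[of "e ` Basis"] by auto
  then have u: "u = (\<Sum>i\<in>Basis. a (e i) *\<^sub>R e i)" by (simp add: sum.reindex[OF inj])
  then have "B u (e i) = a (e i)" if "i \<in> Basis" for i
    using coef[OF that, of "\<lambda>i. a (e i)"] by simp
  then show ?thesis using u by simp
qed

text \<open>Existence and uniqueness are both needed, since the Christoffel map is a definite
  description.\<close>

lemma inner_form_Riesz:
  fixes B :: "'a::euclidean_space \<Rightarrow> 'a \<Rightarrow> real"
  assumes "inner_form B" "linear f"
  shows "\<exists>!w. \<forall>z. B w z = f z"
proof -
  note bil = inner_formD(1)[OF assms(1)]
  obtain e where e: "\<And>i j. i \<in> Basis \<Longrightarrow> j \<in> Basis \<Longrightarrow> B (e i) (e j) = (if i = (j::'a) then 1 else 0)"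
    using inner_form_orthonormal_basis[OF assms(1)] by blast
  have "B (\<Sum>i\<in>Basis. f (e i) *\<^sub>R e i) z = f z" for z
  proof -
    have "B (\<Sum>i\<in>Basis. f (e i) *\<^sub>R e i) z = (\<Sum>i\<in>Basis. B z (e i) * f (e i))"
      using inner_formD(2)[OF assms(1), of z] by (simp add: bilinear_sum_left[OF bil] mult.commute)
    also have "\<dots> = f (\<Sum>i\<in>Basis. B z (e i) *\<^sub>R e i)"
      using assms(2) by (simp add: linear_sum linear_cmul)
    finally show ?thesis by (simp add: orthonormal_expand[OF assms(1) e])
  qed
  moreover have "w = w'" if "\<forall>z. B w z = f z" "\<forall>z. B w' z = f z" for w w'
  proof (rule ccontr)
    assume "w \<noteq> w'"
    then have "B (w - w') (w - w') > 0" by (intro inner_formD(3)[OF assms(1)]) simp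
    then show False using that by (simp add: bilinear_lsub[OF bil])
  qed
  ultimately show ?thesis by blast
qed

text \<open>With \<open>a i = G u (e i)\<close>, the value \<open>B u u\<close> is the sum of
  \<open>a i * a j * B (e i) (e j)\<close> over pairs. The coefficients satisfy
  \<open>sum (a i * a j)^2 = (sum (a i)^2)^2 = 1\<close>, so Cauchy-Schwarz on pairs of indices
  gives the bound.\<close>

lemma abs_le_tensor_norm:
  fixes G B :: "'a::euclidean_space \<Rightarrow> 'a \<Rightarrow> real"
  assumes "inner_form G" "bilinear B" "G u u = 1"
  shows "\<bar>B u u\<bar> \<le> tensor_norm G B"
proof -
  define e where "e = (SOME e. \<forall>i\<in>Basis. \<forall>j\<in>Basis. G (e i) (e j) = (if i = (j::'a) then 1 else 0))"
  have e: "G (e i) (e j) = (if i = j then 1 else 0)" if "i \<in> Basis" "j \<in> Basis" for i j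
    using someI_ex[OF inner_form_orthonormal_basis[OF assms(1)], folded e_def] that by blast
  let ?a = "\<lambda>i. G u (e i)"
  have ex: "u = (\<Sum>i\<in>Basis. ?a i *\<^sub>R e i)" using orthonormal_expand[OF assms(1) e] by simp
  have quad: "C u u = (\<Sum>(i,j)\<in>Basis \<times> Basis. (?a i * ?a j) * C (e i) (e j))" if "bilinear C" for C
    by (subst (1 2) ex) (simp add: bilinear_sum_expand[OF that] sum.cartesian_product)
  have "G u u = (\<Sum>i\<in>Basis. \<Sum>j\<in>Basis. (?a i * ?a j) * G (e i) (e j))"
    using quad[OF inner_formD(1)[OF assms(1)]] by (simp add: sum.cartesian_product)
  also have "\<dots> = (\<Sum>i\<in>Basis. \<Sum>j\<in>Basis. if i = j then (?a i)\<^sup>2 else 0)"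
    by (intro sum.cong refl) (simp add: e power2_eq_square)
  finally have one: "(\<Sum>i\<in>Basis. (?a i)\<^sup>2) = 1" using assms(3) by simp
  have "(\<Sum>(i,j)\<in>Basis \<times> Basis. (?a i * ?a j)\<^sup>2) = (\<Sum>i\<in>Basis. (?a i)\<^sup>2) * (\<Sum>i\<in>Basis. (?a i)\<^sup>2)"
    by (simp add: sum_product sum.cartesian_product power_mult_distrib)
  then have "(B u u)\<^sup>2 \<le> (\<Sum>(i,j)\<in>Basis \<times> Basis. (B (e i) (e j))\<^sup>2)"
    using Cauchy_Schwarz_ineq_sum[of "\<lambda>(i,j). ?a i * ?a j" "\<lambda>(i,j). B (e i) (e j)" "Basis \<times> Basis"]
      quad[OF assms(2)] one by (simp add: split_def)
  then have "\<bar>B u u\<bar> \<le> sqrt (\<Sum>i\<in>Basis. \<Sum>j\<in>Basis. (B (e i) (e j))\<^sup>2)"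
    by (intro real_le_rsqrt) (simp add: sum.cartesian_product)
  then show ?thesis unfolding tensor_norm_def e_def[symmetric] Let_def .
qed

section \<open>Metrics on a domain: Koszul formula and differentiation along curves\<close>

text \<open>This covers two cases at once: the metric \<open>g s\<close> at a frozen time on a chart
  image, and the space-time metric on the product with the closed time interval. Only first
  derivatives of the components are assumed.\<close>

locale metric_field =
  fixes D :: "'v::euclidean_space set" and G :: "'v field2"
  assumes thick_domain: "thick D"
    and inner: "p \<in> D \<Longrightarrow> inner_form (G p)"
    and differentiable: "p \<in> D \<Longrightarrow> (\<lambda>q. G q u v) differentiable (at p within D)"
begin

lemmas bil = inner_formD(1)[OF inner] and sym = inner_formD(2)[OF inner]

lemma has_derivative_metric:
  "p \<in> D \<Longrightarrow> ((\<lambda>q. G q u v) has_derivative (\<lambda>w. metric_deriv D G p w u v)) (at p within D)"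
  using differentiable unfolding metric_deriv_def by (simp add: frechet_derivative_works)

lemma metric_deriv_eqI:
  assumes "p \<in> D" "((\<lambda>q. G q u v) has_derivative f) (at p within D)"
  shows "metric_deriv D G p w u v = f w"
  using thick_has_derivative_unique[OF thick_domain assms(1) has_derivative_metric[OF assms(1)] assms(2)]
  by metis

lemma metric_deriv_linear: "p \<in> D \<Longrightarrow> linear (\<lambda>w. metric_deriv D G p w u v)"
  using has_derivative_metric has_derivative_linear by blast

lemma metric_deriv_sym: "p \<in> D \<Longrightarrow> metric_deriv D G p w u v = metric_deriv D G p w v u"
  by (rule metric_deriv_eqI) (auto intro!: has_derivative_transform[OF _ _ has_derivative_metric] sym)

text \<open>A derivative is taken for each fixed pair of arguments; bilinearity of \<open>G\<close>
  at every nearby point of \<open>D\<close> passes to these derivatives by their uniqueness.\<close>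

lemma metric_deriv_bilinear:
  assumes p: "p \<in> D"
  shows "bilinear (metric_deriv D G p w)"
proof -
  have "metric_deriv D G p w (u + u') v = metric_deriv D G p w u v + metric_deriv D G p w u' v" for u u' v
    by (rule metric_deriv_eqI[OF p])
      (auto intro!: has_derivative_transform[OF p _ has_derivative_add[OF has_derivative_metric[OF p] has_derivative_metric[OF p]]]
        simp: bilinear_ladd[OF bil])
  moreover have "metric_deriv D G p w (r *\<^sub>R u) v = r * metric_deriv D G p w u v" for r u v
    by (rule metric_deriv_eqI[OF p])
      (auto intro!: has_derivative_transform[OF p _ has_derivative_mult_right[OF has_derivative_metric[OF p]]]
        simp: bilinear_lmul[OF bil])
  ultimately have "linear (\<lambda>u. metric_deriv D G p w u v)" for v
    by (intro linearI) auto
  then show ?thesis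
    unfolding bilinear_def using metric_deriv_sym[OF p, of w] by simp
qed

text \<open>The right-hand side is linear in \<open>z\<close>, so the Riesz representation supplies
  the unique vector that the description in \<open>christoffel\<close> refers to.\<close>

lemma Koszul:
  assumes p: "p \<in> D"
  shows "2 * G p (christoffel D G p u v) z =
     metric_deriv D G p u v z + metric_deriv D G p v u z - metric_deriv D G p z u v"
proof -
  let ?f = "\<lambda>z. (metric_deriv D G p u v z + metric_deriv D G p v u z - metric_deriv D G p z u v) / 2"
  have "linear (metric_deriv D G p u v)" "linear (metric_deriv D G p v u)"
    using metric_deriv_bilinear[OF p] by (auto simp: bilinear_def)
  then have "linear ?f"
    using linear_add[OF metric_deriv_linear[OF p, of u v]] linear_cmul[OF metric_deriv_linear[OF p, of u v]]
    by (intro linearI) (simp_all add: linear_add linear_cmul field_simps)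
  then have "\<exists>!w. \<forall>z. G p w z = ?f z" by (rule inner_form_Riesz[OF inner[OF p]])
  then have "\<exists>!w. \<forall>z. 2 * G p w z =
     metric_deriv D G p u v z + metric_deriv D G p v u z - metric_deriv D G p z u v"
    by (simp add: field_simps)
  from theI'[OF this] show ?thesis unfolding christoffel_def by blast
qed

text \<open>Differentiability of \<open>G\<close> is known for constant arguments only, so the
  varying vectors are expanded in \<open>Basis\<close> and the scalar product rule is applied
  termwise. The parameter set is arbitrary, which admits time curves starting or ending at the
  boundary.\<close>

lemma has_derivative_along:
  assumes x: "x \<in> I" and \<gamma>D: "\<gamma> ` I \<subseteq> D"
    and \<gamma>: "(\<gamma> has_vector_derivative \<gamma>') (at x within I)"
    and U: "(U has_vector_derivative U') (at x within I)"
    and V: "(V has_vector_derivative V') (at x within I)"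
  shows "((\<lambda>y. G (\<gamma> y) (U y) (V y)) has_real_derivative
      metric_deriv D G (\<gamma> x) \<gamma>' (U x) (V x) + G (\<gamma> x) U' (V x) + G (\<gamma> x) (U x) V') (at x within I)"
proof -
  have p: "\<gamma> x \<in> D" using x \<gamma>D by blast
  have g: "((\<lambda>y. G (\<gamma> y) i j) has_real_derivative metric_deriv D G (\<gamma> x) \<gamma>' i j) (at x within I)" for i j
  proof -
    have "((\<lambda>q. G q i j) has_derivative (\<lambda>w. metric_deriv D G (\<gamma> x) w i j)) (at (\<gamma> x) within \<gamma> ` I)"
      using has_derivative_subset[OF has_derivative_metric[OF p] \<gamma>D] .
    from has_derivative_in_compose[OF \<gamma>[unfolded has_vector_derivative_def] this]
    show ?thesis using linear_cmul[OF metric_deriv_linear[OF p, of i j]]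
      by (simp add: has_field_derivative_def mult_commute_abs)
  qed
  have u: "((\<lambda>y. U y \<bullet> i) has_real_derivative U' \<bullet> i) (at x within I)"
    and v: "((\<lambda>y. V y \<bullet> i) has_real_derivative V' \<bullet> i) (at x within I)" for i
    using bounded_linear.has_vector_derivative[OF bounded_linear_inner_left U]
      bounded_linear.has_vector_derivative[OF bounded_linear_inner_left V]
    by (auto simp: has_real_derivative_iff_has_vector_derivative)
  have "((\<lambda>y. \<Sum>i\<in>Basis. \<Sum>j\<in>Basis. (U y \<bullet> i) * (V y \<bullet> j) * G (\<gamma> y) i j) has_real_derivative
      (\<Sum>i\<in>Basis. \<Sum>j\<in>Basis. ((U' \<bullet> i) * (V x \<bullet> j) + (V' \<bullet> j) * (U x \<bullet> i)) * G (\<gamma> x) i j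
         + metric_deriv D G (\<gamma> x) \<gamma>' i j * ((U x \<bullet> i) * (V x \<bullet> j)))) (at x within I)"
    by (intro DERIV_sum DERIV_mult u v g)
  also have "(\<Sum>i\<in>Basis. \<Sum>j\<in>Basis. ((U' \<bullet> i) * (V x \<bullet> j) + (V' \<bullet> j) * (U x \<bullet> i)) * G (\<gamma> x) i j
         + metric_deriv D G (\<gamma> x) \<gamma>' i j * ((U x \<bullet> i) * (V x \<bullet> j))) =
     metric_deriv D G (\<gamma> x) \<gamma>' (U x) (V x) + G (\<gamma> x) U' (V x) + G (\<gamma> x) (U x) V'"
    unfolding bilinear_Basis_expand[OF metric_deriv_bilinear[OF p], of _ "U x"]
      bilinear_Basis_expand[OF bil[OF p], of U'] bilinear_Basis_expand[OF bil[OF p], of "U x"]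
    by (simp add: sum.distrib[symmetric] algebra_simps)
  finally show ?thesis unfolding has_field_derivative_def
  proof (rule has_derivative_transform[OF x, rotated])
    fix y assume "y \<in> I"
    then have "\<gamma> y \<in> D" using \<gamma>D by blast
    then show "G (\<gamma> y) (U y) (V y) = (\<Sum>i\<in>Basis. \<Sum>j\<in>Basis. (U y \<bullet> i) * (V y \<bullet> j) * G (\<gamma> y) i j)"
      by (rule bilinear_Basis_expand[OF bil])
  qed
qed

text \<open>Compatibility of the connection with the metric: with \<open>z = V x\<close> the last
  two terms of the Koszul formula cancel, leaving exactly the derivative of \<open>G\<close> in the
  direction of the curve.\<close>

lemma norm_sq_derivative_along:
  assumes I: "open I" "x \<in> I" and \<gamma>D: "\<gamma> ` I \<subseteq> D"
    and \<gamma>: "(\<gamma> has_vector_derivative \<gamma>') (at x)"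
    and V: "(V has_vector_derivative V') (at x)"
  shows "((\<lambda>y. G (\<gamma> y) (V y) (V y)) has_real_derivative
      2 * G (\<gamma> x) (cov_deriv_along D G \<gamma> V x) (V x)) (at x)"
proof -
  have p: "\<gamma> x \<in> D" using I \<gamma>D by blast
  have w: "at x within I = at x" by (rule at_within_open[OF I(2,1)])
  have "((\<lambda>y. G (\<gamma> y) (V y) (V y)) has_real_derivative
      metric_deriv D G (\<gamma> x) \<gamma>' (V x) (V x) + G (\<gamma> x) V' (V x) + G (\<gamma> x) (V x) V') (at x)"
    using has_derivative_along[OF I(2) \<gamma>D, of \<gamma>' V V' V V'] \<gamma> V unfolding w by blast
  moreover have "cov_deriv_along D G \<gamma> V x = V' + christoffel D G (\<gamma> x) \<gamma>' (V x)"
    unfolding cov_deriv_along_def using vector_derivative_at[OF \<gamma>] vector_derivative_at[OF V] by simp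
  ultimately show ?thesis
    using Koszul[OF p, of \<gamma>' "V x" "V x"] metric_deriv_sym[OF p, of "V x" \<gamma>' "V x"] sym[OF p, of V' "V x"]
    by (simp add: bilinear_ladd[OF bil[OF p]])
qed

section \<open>Unit tangent and curvature vector of a curve in a fixed metric\<close>

context
  fixes I :: "real set" and \<gamma> X S S' H :: "real \<Rightarrow> 'v" and v :: "real \<Rightarrow> real"
  assumes I: "open I" and \<gamma>D: "\<gamma> ` I \<subseteq> D"
    and \<gamma>: "\<And>y. y \<in> I \<Longrightarrow> (\<gamma> has_vector_derivative X y) (at y)"
    and S: "\<And>y. y \<in> I \<Longrightarrow> (S has_vector_derivative S' y) (at y)"
    and X: "\<And>y. y \<in> I \<Longrightarrow> X y = v y *\<^sub>R S y"
    and v: "\<And>y. y \<in> I \<Longrightarrow> v y > 0"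
    and unit: "\<And>y. y \<in> I \<Longrightarrow> G (\<gamma> y) (S y) (S y) = 1"
    and H: "\<And>y. y \<in> I \<Longrightarrow> H y = cov_deriv_along D G \<gamma> S y /\<^sub>R v y"
begin

lemma curvature_orthogonal:
  assumes y: "y \<in> I"
  shows "G (\<gamma> y) (H y) (S y) = 0"
proof -
  have "((\<lambda>y. 1) has_real_derivative 2 * G (\<gamma> y) (cov_deriv_along D G \<gamma> S y) (S y)) (at y)"
    by (rule has_field_derivative_transform_within_open[OF
          norm_sq_derivative_along[OF I y \<gamma>D \<gamma>[OF y] S[OF y]] I y unit])
  then have "G (\<gamma> y) (cov_deriv_along D G \<gamma> S y) (S y) = 0"
    using DERIV_unique DERIV_const by fastforce
  moreover have "\<gamma> y \<in> D" using y \<gamma>D by blast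
  ultimately show ?thesis unfolding H[OF y] by (simp add: bilinear_lmul[OF bil])
qed

text \<open>When the curve moves with velocity \<open>H\<close> in a fixed metric, the coordinates
  of \<open>X\<close> change at the rate \<open>H'\<close>, so the left-hand side is the rate of
  change of \<open>|X|^2\<close>. It is found by differentiating the orthogonality of
  \<open>H\<close> and \<open>S\<close> along the curve.\<close>

lemma first_variation:
  assumes y: "y \<in> I" and H': "(H has_vector_derivative H') (at y)"
  shows "metric_deriv D G (\<gamma> y) (H y) (X y) (X y) + 2 * G (\<gamma> y) H' (X y)
    = - 2 * (v y)\<^sup>2 * G (\<gamma> y) (H y) (H y)"
proof -
  have p: "\<gamma> y \<in> D" using y \<gamma>D by blast
  note b = bil[OF p] and mb = metric_deriv_bilinear[OF p]
  have w: "at y within I = at y" by (rule at_within_open[OF y I])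
  have "((\<lambda>y. G (\<gamma> y) (H y) (S y)) has_real_derivative
     metric_deriv D G (\<gamma> y) (X y) (H y) (S y) + G (\<gamma> y) H' (S y) + G (\<gamma> y) (H y) (S' y)) (at y)"
    using has_derivative_along[OF y \<gamma>D, of "X y" H H' S "S' y"] \<gamma>[OF y] S[OF y] H' unfolding w by blast
  then have "((\<lambda>y. 0) has_real_derivative
     metric_deriv D G (\<gamma> y) (X y) (H y) (S y) + G (\<gamma> y) H' (S y) + G (\<gamma> y) (H y) (S' y)) (at y)"
    by (rule has_field_derivative_transform_within_open[OF _ I y curvature_orthogonal])
  then have 0: "metric_deriv D G (\<gamma> y) (X y) (H y) (S y) + G (\<gamma> y) H' (S y) + G (\<gamma> y) (H y) (S' y) = 0"
    using DERIV_unique DERIV_const by blast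
  let ?\<Gamma> = "christoffel D G (\<gamma> y) (X y) (S y)"
  have S': "S' y = v y *\<^sub>R H y - ?\<Gamma>"
    using H[OF y] v[OF y] vector_derivative_at[OF \<gamma>[OF y]] vector_derivative_at[OF S[OF y]]
    by (simp add: cov_deriv_along_def)
  have lin: "metric_deriv D G (\<gamma> y) (X y) a b = v y * metric_deriv D G (\<gamma> y) (S y) a b" for a b
    using linear_cmul[OF metric_deriv_linear[OF p, of a b]] X[OF y] by simp
  \<comment> \<open>The Koszul formula rewrites the Christoffel term by metric derivatives. Its part
    in direction \<open>S\<close> cancels against the metric derivative in \<open>0\<close>; the
    part in direction \<open>H\<close> is the one in the claim.\<close>
  have "2 * G (\<gamma> y) (H y) ?\<Gamma> = 2 * (v y * metric_deriv D G (\<gamma> y) (S y) (H y) (S y))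
      - v y * metric_deriv D G (\<gamma> y) (H y) (S y) (S y)"
    using Koszul[OF p, of "X y" "S y" "H y"] sym[OF p, of "H y" ?\<Gamma>]
      metric_deriv_sym[OF p, of "S y" "H y" "S y"]
    by (simp add: lin) (simp add: X[OF y] bilinear_lmul[OF mb])
  then have "2 * G (\<gamma> y) H' (S y) + 2 * v y * G (\<gamma> y) (H y) (H y)
      + v y * metric_deriv D G (\<gamma> y) (H y) (S y) (S y) = 0"
    using 0 by (simp add: S' lin bilinear_rsub[OF b] bilinear_rmul[OF b])
  \<comment> \<open>One more factor \<open>v y\<close> turns \<open>S\<close> into \<open>X\<close>
    in each slot.\<close>
  then have "v y * (2 * G (\<gamma> y) H' (S y) + 2 * v y * G (\<gamma> y) (H y) (H y)
      + v y * metric_deriv D G (\<gamma> y) (H y) (S y) (S y)) = 0" by simp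
  then show ?thesis
    by (simp add: X[OF y] bilinear_lmul[OF mb] bilinear_rmul[OF mb] bilinear_rmul[OF b]
        power2_eq_square algebra_simps)
qed

end

end

section \<open>Integrated evolution of length and curvature\<close>

text \<open>All geometry is condensed into scalars: \<open>K\<close> stands for the squared
  curvature, \<open>P\<close> for \<open>|X|^2\<close> and \<open>N\<close> for the squared norm of
  the normal part of the derivative of \<open>H\<close>. \<open>P_evolution\<close> contains the
  Ricci bound, and \<open>K_gradient\<close> is the Cauchy-Schwarz estimate with the factor
  \<open>P\<close> from passing from arc length to the parameter \<open>x\<close>.\<close>

locale curvature_evolution =
  fixes T C2 Chat :: real and K P N :: "real \<times> real \<Rightarrow> real"
  assumes T_pos: "0 < T"
    and K_C2: "Ck_on (Suc (Suc 0)) (strip T) K"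
    and P_C1: "Ck_on (Suc 0) (strip T) P"
    and K_nonneg: "z \<in> strip T \<Longrightarrow> 0 \<le> K z"
    and P_pos: "z \<in> strip T \<Longrightarrow> 0 < P z"
    and N_nonneg: "z \<in> strip T \<Longrightarrow> 0 \<le> N z"
    and K_periodic: "s \<in> {0..T} \<Longrightarrow> K (x + 2 * pi, s) = K (x, s)"
    and P_periodic: "s \<in> {0..T} \<Longrightarrow> P (x + 2 * pi, s) = P (x, s)"
    and Chat_nonneg: "0 \<le> Chat" and C2_nonneg: "0 \<le> C2"
    and P_evolution: "z \<in> strip T \<Longrightarrow> dt T P z \<le> 2 * P z * (C2 - K z)"
    and K_gradient: "z \<in> strip T \<Longrightarrow> (dx T K z)\<^sup>2 \<le> 4 * P z * (N z * K z)"
    and K_evolution: "s \<in> {0..T} \<Longrightarrow> dt T K (x, s) \<le>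
        deriv (\<lambda>y. dx T K (y, s) / sqrt (P (y, s))) x / sqrt (P (x, s))
        - 2 * N (x, s) + 2 * (K (x, s))\<^sup>2 + Chat * (K (x, s) + sqrt (K (x, s)))"
begin

abbreviation "v z \<equiv> sqrt (P z)"
abbreviation "k z \<equiv> sqrt (K z)"
abbreviation "kreg e z \<equiv> sqrt (K z + e\<^sup>2)"

definition "len s = integral {0..2 * pi} (\<lambda>x. v (x, s))"
definition "curv s = integral {0..2 * pi} (\<lambda>x. k (x, s) * v (x, s))"
definition "curv_reg e s = integral {0..2 * pi} (\<lambda>x. kreg e (x, s) * v (x, s))"

lemma K_C1: "Ck_on (Suc 0) (strip T) K"
  by (rule Ck_on_Suc_imp[OF K_C2])

lemma v_C1: "Ck_on (Suc 0) (strip T) v"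
  by (intro Ck_on_1_sqrt thick_strip T_pos P_C1 P_pos)

lemma kreg_C1: "0 < e \<Longrightarrow> Ck_on (Suc 0) (strip T) (kreg e)"
  using K_nonneg
  by (intro Ck_on_1_sqrt Ck_on_add Ck_on_const thick_strip T_pos K_C1) (simp add: add_nonneg_pos)

lemmas cont_v = Ck_on_continuous[OF v_C1]
  and cont_K = Ck_on_continuous[OF K_C1]

lemma cont_k: "continuous_on (strip T) k"
  using cont_K by (intro continuous_intros)

lemma cont_kreg: "continuous_on (strip T) (kreg e)"
  using cont_K by (intro continuous_intros)

lemma v_pos: "s \<in> {0..T} \<Longrightarrow> 0 < v (x, s)"
  using P_pos by simp

lemma length_derivative:
  assumes s: "s \<in> {0..T}"
  shows "\<exists>L'. (len has_real_derivative L') (at s within {0..T}) \<and>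
    L' \<le> integral {0..2 * pi} (\<lambda>x. (C2 - K (x, s)) * v (x, s))"
proof (intro exI conjI)
  show "(len has_real_derivative integral {0..2 * pi} (\<lambda>x. dt T v (x, s))) (at s within {0..T})"
    unfolding len_def by (rule integral_strip_derivative[OF v_C1 s])
  show "integral {0..2 * pi} (\<lambda>x. dt T v (x, s)) \<le> integral {0..2 * pi} (\<lambda>x. (C2 - K (x, s)) * v (x, s))"
  proof (rule integral_le)
    show "(\<lambda>x. dt T v (x, s)) integrable_on {0..2 * pi}"
      using Ck_on_partial[OF v_C1] s
      by (intro integrable_continuous_real continuous_on_strip_slice) auto
    show "(\<lambda>x. (C2 - K (x, s)) * v (x, s)) integrable_on {0..2 * pi}"
      by (intro integrable_continuous_real continuous_intros continuous_on_strip_slice[OF cont_v s]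
          continuous_on_strip_slice[OF cont_K s] continuous_on_strip_slice[OF Ck_on_continuous[OF P_C1] s])
    fix x
    have z: "(x, s) \<in> strip T" using s by simp
    have "((\<lambda>r. v (x, r)) has_real_derivative inverse (v (x, s)) / 2 * dt T P (x, s)) (at s within {0..T})"
      by (rule DERIV_sqrt_comp[OF dx_dt(2)[OF P_C1 s] P_pos[OF z]])
    then have "dt T v (x, s) = inverse (v (x, s)) / 2 * dt T P (x, s)"
      by (rule DERIV_unique_Icc[OF T_pos s dx_dt(2)[OF v_C1 s]])
    also have "\<dots> \<le> inverse (v (x, s)) / 2 * (2 * P (x, s) * (C2 - K (x, s)))"
      using P_evolution[OF z] P_pos[OF z] by (intro mult_left_mono) auto
    also have "\<dots> = (C2 - K (x, s)) * v (x, s)"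
      using P_pos[OF z] by (simp add: field_simps)
    finally show "dt T v (x, s) \<le> (C2 - K (x, s)) * v (x, s)" .
  qed
qed

text \<open>Here \<open>h = k\<^sub>\<epsilon>\<close>, \<open>u = |X|\<close>, \<open>K' = \<partial>\<^sub>x (k\<^sup>2)\<close> and \<open>q = \<partial>\<^sub>x (K' / u)\<close>. The parenthesised term on the right is
  \<open>\<partial>\<^sub>x (\<partial>\<^sub>x h / u)\<close>, whose integral over the circle vanishes.\<close>

lemma regularized_evolution_pointwise:
  fixes q K' Kt Pt n K0 u e :: real
  assumes "0 \<le> K0" "0 < u" "0 < e" "0 \<le> n"
    and grad: "K'\<^sup>2 \<le> 4 * u\<^sup>2 * (n * K0)"
    and Kt: "Kt \<le> q / u - 2 * n + 2 * K0\<^sup>2 + Chat * (K0 + sqrt K0)"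
    and Pt: "Pt \<le> 2 * u\<^sup>2 * (C2 - K0)"
  defines "h \<equiv> sqrt (K0 + e\<^sup>2)"
  shows "Kt / (2 * h) * u + h * (Pt / (2 * u)) \<le>
    (q / (2 * h) - K'\<^sup>2 / (4 * u * h ^ 3)) + Chat / 2 * (sqrt K0 + 1) * u + C2 * h * u"
proof -
  have h2: "h\<^sup>2 = K0 + e\<^sup>2" unfolding h_def using assms(1) by simp
  have h: "0 < h" unfolding h_def using assms(1,3) by (simp add: add_nonneg_pos)
  have Kh: "K0 \<le> h\<^sup>2" using h2 by simp
  have kh: "sqrt K0 \<le> h" unfolding h_def by simp
  have "Kt / (2 * h) * u \<le> (q / u - 2 * n + 2 * K0\<^sup>2 + Chat * (K0 + sqrt K0)) / (2 * h) * u"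
    using Kt h assms(2) by (intro mult_right_mono divide_right_mono) auto
  also have "\<dots> = q / (2 * h) - n * u / h + K0\<^sup>2 * u / h + Chat / 2 * ((K0 + sqrt K0) / h) * u"
    using h assms(2) by (simp add: field_simps)
  finally have 1: "Kt / (2 * h) * u \<le>
     q / (2 * h) - n * u / h + K0\<^sup>2 * u / h + Chat / 2 * ((K0 + sqrt K0) / h) * u" .
  \<comment> \<open>The left-hand side is the square that arises when the derivative of
    \<open>K' / u * (1 / (2 * h))\<close> hits \<open>1 / h\<close>. The gradient bound together
    with \<open>K0\<close> being at most the square of \<open>h\<close> lets
    \<open>n * u / h\<close> dominate it.\<close>
  have "K'\<^sup>2 / (4 * u * h ^ 3) \<le> (4 * u\<^sup>2 * (n * h\<^sup>2)) / (4 * u * h ^ 3)"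
    using grad Kh assms(2,4) h
    by (intro divide_right_mono order_trans[OF grad] mult_left_mono) auto
  also have "\<dots> = n * u / h" using h assms(2) by (simp add: field_simps power2_eq_square power3_eq_cube)
  finally have 2: "K'\<^sup>2 / (4 * u * h ^ 3) \<le> n * u / h" .
  \<comment> \<open>The resulting bound \<open>K0 * h * u\<close> is exactly what the shrinking of
    the length element subtracts below.\<close>
  have "K0\<^sup>2 * u / h \<le> (K0 * h\<^sup>2) * u / h"
    using Kh assms(1,2) h by (intro divide_right_mono mult_right_mono) (auto simp: power2_eq_square mult_left_mono)
  then have 3: "K0\<^sup>2 * u / h \<le> K0 * h * u" using h by (simp add: power2_eq_square field_simps)
  \<comment> \<open>Bounding one factor \<open>sqrt K0\<close> by \<open>h\<close> in each summand
    makes the quotient by \<open>h\<close> bounded independently of \<open>e\<close>, even where the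
    curvature vanishes.\<close>
  have "sqrt K0 * sqrt K0 + sqrt K0 \<le> sqrt K0 * h + h"
    using kh assms(1) by (intro add_mono mult_left_mono) auto
  then have "(K0 + sqrt K0) / h \<le> sqrt K0 + 1" using h assms(1) by (simp add: field_simps)
  then have 4: "Chat / 2 * ((K0 + sqrt K0) / h) * u \<le> Chat / 2 * (sqrt K0 + 1) * u"
    using Chat_nonneg assms(2) by (intro mult_right_mono mult_left_mono) auto
  have "h * (Pt / (2 * u)) \<le> h * ((2 * u\<^sup>2 * (C2 - K0)) / (2 * u))"
    using Pt h assms(2) by (intro mult_left_mono divide_right_mono) auto
  also have "\<dots> = C2 * h * u - K0 * h * u"
    using assms(2) by (simp add: field_simps power2_eq_square)
  finally show ?thesis using 1 2 3 4 by linarith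
qed

lemma dx_periodic:
  assumes "Ck_on (Suc n) (strip T) f" "\<And>x. f (x + 2 * pi, s) = f (x, s)" "s \<in> {0..T}"
  shows "dx T f (x + 2 * pi, s) = dx T f (x, s)"
proof -
  have "((\<lambda>y. f (y + 2 * pi, s)) has_real_derivative dx T f (x + 2 * pi, s)) (at x)"
    using dx_dt(1)[OF assms(1,3), of "x + 2 * pi"] DERIV_shift[of "\<lambda>y. f (y, s)"] by simp
  then show ?thesis using DERIV_unique[OF dx_dt(1)[OF assms(1,3)]] assms(2) by simp
qed

text \<open>The time derivative of the integrand is at most \<open>R + B\<close>, where
  \<open>R\<close> is the exact \<open>x\<close>-derivative of a periodic function and
  \<open>B\<close> integrates to the claimed bound.\<close>

lemma curv_reg_derivative:
  assumes e: "0 < e" and s: "s \<in> {0..T}"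
  shows "\<exists>E'. (curv_reg e has_real_derivative E') (at s within {0..T}) \<and>
    E' \<le> Chat / 2 * (curv s + len s) + C2 * curv_reg e s"
proof (intro exI conjI)
  let ?f = "\<lambda>z. kreg e z * v z"
  have f: "Ck_on (Suc 0) (strip T) ?f"
    by (intro Ck_on_mult thick_strip T_pos kreg_C1 v_C1 e)
  show "(curv_reg e has_real_derivative integral {0..2 * pi} (\<lambda>x. dt T ?f (x, s))) (at s within {0..T})"
    unfolding curv_reg_def by (rule integral_strip_derivative[OF f s])
  define q where "q x = deriv (\<lambda>y. dx T K (y, s) / v (y, s)) x" for x
  define R where "R x = q x / (2 * kreg e (x, s)) - (dx T K (x, s))\<^sup>2 / (4 * v (x, s) * kreg e (x, s) ^ 3)" for x
  define B where "B x = Chat / 2 * (k (x, s) + 1) * v (x, s) + C2 * kreg e (x, s) * v (x, s)" for x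
  have hpos: "0 < kreg e (x, s)" for x
    using K_nonneg[of "(x, s)"] e s by (simp add: add_nonneg_pos)
  have le: "dt T ?f (x, s) \<le> R x + B x" for x
  proof -
    have z: "(x, s) \<in> strip T" using s by simp
    have "((\<lambda>r. v (x, r)) has_real_derivative inverse (v (x, s)) / 2 * dt T P (x, s)) (at s within {0..T})"
      by (rule DERIV_sqrt_comp[OF dx_dt(2)[OF P_C1 s] P_pos[OF z]])
    moreover have "((\<lambda>r. K (x, r) + e\<^sup>2) has_real_derivative dt T K (x, s)) (at s within {0..T})"
      using DERIV_add[OF dx_dt(2)[OF K_C1 s] DERIV_const] by simp
    then have "((\<lambda>r. kreg e (x, r)) has_real_derivative inverse (kreg e (x, s)) / 2 * dt T K (x, s)) (at s within {0..T})"
      by (rule DERIV_sqrt_comp) (use hpos[of x] in simp)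
    ultimately have "((\<lambda>r. ?f (x, r)) has_real_derivative
       (inverse (kreg e (x, s)) / 2 * dt T K (x, s)) * v (x, s)
        + (inverse (v (x, s)) / 2 * dt T P (x, s)) * kreg e (x, s)) (at s within {0..T})"
      by (intro DERIV_mult)
    then have "dt T ?f (x, s) = (inverse (kreg e (x, s)) / 2 * dt T K (x, s)) * v (x, s)
        + (inverse (v (x, s)) / 2 * dt T P (x, s)) * kreg e (x, s)"
      by (rule DERIV_unique_Icc[OF T_pos s dx_dt(2)[OF f s]])
    also have "\<dots> = dt T K (x, s) / (2 * kreg e (x, s)) * v (x, s)
        + kreg e (x, s) * (dt T P (x, s) / (2 * v (x, s)))"
      by (simp add: field_simps)
    also have "\<dots> \<le> (q x / (2 * kreg e (x, s)) - (dx T K (x, s))\<^sup>2 / (4 * v (x, s) * kreg e (x, s) ^ 3))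
       + Chat / 2 * (sqrt (K (x, s)) + 1) * v (x, s) + C2 * kreg e (x, s) * v (x, s)"
      by (rule regularized_evolution_pointwise[where n = "N (x, s)"])
        (use K_nonneg[OF z] v_pos[OF s] e N_nonneg[OF z] K_gradient[OF z] K_evolution[OF s, of x] P_pos[OF z]
          P_evolution[OF z] in \<open>auto simp: q_def real_sqrt_pow2[OF less_imp_le[OF P_pos[OF z]]]\<close>)
    finally show ?thesis by (simp add: R_def B_def)
  qed
  have "((\<lambda>x. dx T K (x, s) / v (x, s) / (2 * kreg e (x, s))) has_real_derivative R x) (at x)" for x
  proof -
    have z: "(x, s) \<in> strip T" using s by simp
    have "((\<lambda>y. dx T K (y, s)) has_real_derivative dx T (dx T K) (x, s)) (at x)"
      by (rule dx_dt(1)[OF Ck_on_partial[OF K_C2] s])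
    then have "(\<lambda>y. dx T K (y, s) / v (y, s)) field_differentiable at x"
      using dx_dt(1)[OF v_C1 s, of x] v_pos[OF s, of x]
      by (intro field_differentiable_divide) (auto simp: field_differentiable_def)
    then have "((\<lambda>y. dx T K (y, s) / v (y, s)) has_real_derivative q x) (at x)"
      unfolding q_def by (simp add: field_differentiable_derivI)
    moreover have "((\<lambda>r. K (r, s) + e\<^sup>2) has_real_derivative dx T K (x, s)) (at x)"
      using DERIV_add[OF dx_dt(1)[OF K_C1 s] DERIV_const] by simp
    then have "((\<lambda>r. kreg e (r, s)) has_real_derivative inverse (kreg e (x, s)) / 2 * dx T K (x, s)) (at x)"
      by (rule DERIV_sqrt_comp) (use hpos[of x] in simp)
    then have "((\<lambda>r. 2 * kreg e (r, s)) has_real_derivative 2 * (inverse (kreg e (x, s)) / 2 * dx T K (x, s))) (at x)"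
      by (rule DERIV_cmult)
    ultimately have "((\<lambda>x. dx T K (x, s) / v (x, s) / (2 * kreg e (x, s))) has_real_derivative
       (q x * (2 * kreg e (x, s)) - dx T K (x, s) / v (x, s) * (2 * (inverse (kreg e (x, s)) / 2 * dx T K (x, s))))
       / (2 * kreg e (x, s) * (2 * kreg e (x, s)))) (at x)"
      by (rule DERIV_divide) (use hpos[of x] in simp)
    also have "(q x * (2 * h) - d / w * (2 * (inverse h / 2 * d))) / (2 * h * (2 * h))
       = q x / (2 * h) - d\<^sup>2 / (4 * w * h ^ 3)" if "h \<noteq> 0" "w \<noteq> 0" for h w d
      using that by (simp add: field_simps power2_eq_square power3_eq_cube)
    then have "(q x * (2 * kreg e (x, s)) - dx T K (x, s) / v (x, s) * (2 * (inverse (kreg e (x, s)) / 2 * dx T K (x, s))))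
       / (2 * kreg e (x, s) * (2 * kreg e (x, s))) = R x"
      unfolding R_def using hpos[of x] v_pos[OF s, of x] by (metis less_irrefl)
    finally show ?thesis .
  qed
  \<comment> \<open>The primitive is the \<open>x\<close>-derivative of \<open>kreg e\<close>
    divided by \<open>v\<close>. The fundamental theorem yields integrability of \<open>R\<close>
    along with its integral, so no continuity of \<open>q\<close> has to be known; periodicity then
    makes the boundary values cancel.\<close>
  then have "(R has_integral dx T K (2 * pi, s) / v (2 * pi, s) / (2 * kreg e (2 * pi, s))
     - dx T K (0, s) / v (0, s) / (2 * kreg e (0, s))) {0..2 * pi}"
    by (intro fundamental_theorem_of_calculus)
      (auto simp: has_real_derivative_iff_has_vector_derivative intro: has_vector_derivative_at_within)
  then have R: "(R has_integral 0) {0..2 * pi}"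
    using dx_periodic[OF K_C1 K_periodic[OF s] s, of 0] K_periodic[OF s, of 0] P_periodic[OF s, of 0]
    by simp
  note cs = continuous_on_strip_slice[OF _ s]
  have iv: "(\<lambda>x. v (x, s)) integrable_on {0..2 * pi}"
    and ikv: "(\<lambda>x. k (x, s) * v (x, s)) integrable_on {0..2 * pi}"
    and irv: "(\<lambda>x. kreg e (x, s) * v (x, s)) integrable_on {0..2 * pi}"
    by (intro integrable_continuous_real continuous_on_mult cs cont_v cont_k cont_kreg)+
  have "(B has_integral Chat / 2 * (curv s + len s) + C2 * curv_reg e s) {0..2 * pi}"
    unfolding B_def curv_def len_def curv_reg_def
    using has_integral_add[OF has_integral_mult_right[OF has_integral_add[OF
            integrable_integral[OF ikv] integrable_integral[OF iv]], of "Chat / 2"]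
          has_integral_mult_right[OF integrable_integral[OF irv], of C2]]
    by (simp add: algebra_simps)
  from has_integral_add[OF R this]
  have "((\<lambda>x. R x + B x) has_integral Chat / 2 * (curv s + len s) + C2 * curv_reg e s) {0..2 * pi}"
    by simp
  moreover have "(\<lambda>x. dt T ?f (x, s)) integrable_on {0..2 * pi}"
    using Ck_on_partial[OF f] s
    by (intro integrable_continuous_real continuous_on_strip_slice) auto
  ultimately show "integral {0..2 * pi} (\<lambda>x. dt T ?f (x, s)) \<le> Chat / 2 * (curv s + len s) + C2 * curv_reg e s"
    using has_integral_le[OF integrable_integral] le by blast
qed

section \<open>Removing the regularization\<close>

text \<open>Subadditivity of the square root gives \<open>k <= kreg e <= k + e\<close> pointwise.
  The bounds serve for the limit as \<open>e\<close> tends to 0 and for replacing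
  \<open>curv_reg\<close> by \<open>curv\<close> in the differential inequality at the cost
  \<open>e * len\<close>.\<close>

lemma curv_reg_bounds:
  assumes e: "0 < e" and s: "s \<in> {0..T}"
  shows "curv s \<le> curv_reg e s" "curv_reg e s \<le> curv s + e * len s"
proof -
  note cs = continuous_on_strip_slice[OF _ s]
  have iv: "(\<lambda>x. v (x, s)) integrable_on {0..2 * pi}"
    and ikv: "(\<lambda>x. k (x, s) * v (x, s)) integrable_on {0..2 * pi}"
    and irv: "(\<lambda>x. kreg e (x, s) * v (x, s)) integrable_on {0..2 * pi}"
    by (intro integrable_continuous_real continuous_on_mult cs cont_v cont_k cont_kreg)+
  show "curv s \<le> curv_reg e s"
    unfolding curv_def curv_reg_def
    using v_pos[OF s] by (intro integral_le ikv irv mult_right_mono) (auto simp: less_imp_le)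
  have "curv_reg e s \<le> integral {0..2 * pi} (\<lambda>x. k (x, s) * v (x, s) + e * v (x, s))"
    unfolding curv_reg_def
  proof (intro integral_le irv integrable_add ikv integrable_on_mult_right iv)
    fix x
    have "kreg e (x, s) \<le> k (x, s) + e"
      using sqrt_add_le_add_sqrt[of "K (x, s)" "e\<^sup>2"] K_nonneg[of "(x, s)"] s e by simp
    then show "kreg e (x, s) * v (x, s) \<le> k (x, s) * v (x, s) + e * v (x, s)"
      using v_pos[OF s, of x] by (simp add: distrib_right[symmetric] mult_right_mono)
  qed
  also have "\<dots> = curv s + e * len s"
    unfolding curv_def len_def using ikv iv by (simp add: integral_add integrable_on_mult_right)
  finally show "curv_reg e s \<le> curv s + e * len s" .
qed

lemma len_continuous: "continuous_on {0..T} len"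
  using length_derivative by (meson DERIV_continuous_on)

lemma curv_continuous: "continuous_on {0..T} curv"
proof -
  have "continuous_on ({0..T} \<times> cbox 0 (2 * pi)) (\<lambda>(s, x). k (x, s) * v (x, s))"
    unfolding split_def
    by (intro continuous_on_mult continuous_on_compose2[OF cont_k] continuous_on_compose2[OF cont_v]
        continuous_intros) auto
  then show ?thesis
    unfolding curv_def using integral_continuous_on_param[of "{0..T}" 0 "2 * pi"] by simp
qed

text \<open>The differential inequality for \<open>curv_reg e\<close> has right-hand side at most
  \<open>\<rho>\<close> plus a multiple of \<open>e\<close>. Near \<open>t\<close> the continuous
  function \<open>\<rho>\<close> exceeds \<open>\<rho> t\<close> by less than
  \<open>\<delta>\<close>, on a neighbourhood chosen independently of \<open>e\<close>, so
  \<open>e\<close> may tend to 0 with \<open>s\<close> fixed.\<close>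

lemma curv_upper_deriv:
  assumes t: "t \<in> {0..T}"
  shows "upper_deriv curv t {0..T} \<le> ereal ((Chat / 2 + C2) * curv t + Chat / 2 * len t)"
proof -
  define \<rho> where "\<rho> s = (Chat / 2 + C2) * curv s + Chat / 2 * len s" for s
  have \<rho>: "continuous_on {0..T} \<rho>"
    unfolding \<rho>_def by (intro continuous_intros curv_continuous len_continuous)
  have main: "\<forall>\<^sub>F s in at t within {0..T}. (curv s - curv t) / (s - t) \<le> \<rho> t + \<delta>" if "\<delta> > 0" for \<delta>
  proof -
    obtain d where d: "d > 0" "\<And>s. s \<in> {0..T} \<Longrightarrow> dist s t < d \<Longrightarrow> dist (\<rho> s) (\<rho> t) < \<delta>"
      using \<rho> t \<open>\<delta> > 0\<close> unfolding continuous_on_iff by blast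
    \<comment> \<open>The intermediate time supplied by the mean value theorem depends on
      \<open>e\<close>, so the error \<open>e * len r\<close> needs a bound uniform in time.\<close>
    obtain M where M: "\<And>s. s \<in> {0..T} \<Longrightarrow> len s \<le> M"
      using compact_imp_bounded[OF compact_continuous_image[OF len_continuous compact_Icc]]
      unfolding bounded_iff by (metis abs_le_D1 imageI real_norm_def)
    have reg: "(curv_reg e s - curv_reg e t) / (s - t) \<le> \<rho> t + \<delta> + C2 * e * M"
      if s: "s \<in> {0..T}" "s \<noteq> t" "dist s t < d" and e: "0 < e" for s e
    proof -
      obtain E' where E': "\<And>r. r \<in> {0..T} \<Longrightarrow> (curv_reg e has_real_derivative E' r) (at r within {0..T})"
        "\<And>r. r \<in> {0..T} \<Longrightarrow> E' r \<le> Chat / 2 * (curv r + len r) + C2 * curv_reg e r"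
        using curv_reg_derivative[OF e] by metis
      have "\<exists>r\<in>{a<..<b}. curv_reg e b - curv_reg e a = E' r * (b - a)"
        if "a < b" "0 \<le> a" "b \<le> T" for a b
      proof (rule mvt_simple[OF \<open>a < b\<close>, where f' = "\<lambda>r. (*) (E' r)"])
        fix r assume "a \<le> r" "r \<le> b"
        then show "(curv_reg e has_derivative (*) (E' r)) (at r within {a..b})"
          using has_derivative_subset[OF E'(1)[unfolded has_field_derivative_def], of r "{a..b}"] that by auto
      qed
      note mvt = this
      \<comment> \<open>Exchanging \<open>s\<close> and \<open>t\<close> does not change the
        quotient, so forward and backward quotients are both values of \<open>E'\<close> at a time
        at least as close to \<open>t\<close> as \<open>s\<close> is.\<close>
      obtain r where
        r: "r \<in> {min s t..max s t}" "(curv_reg e s - curv_reg e t) / (s - t) = E' r"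
      proof (cases "s < t")
        case True
        then obtain r where "r \<in> {s<..<t}" "curv_reg e t - curv_reg e s = E' r * (t - s)"
          using mvt[of s t] s t by auto
        then show ?thesis using True by (intro that[of r]) (auto simp: divide_simps algebra_simps)
      next
        case False
        then obtain r where "r \<in> {t<..<s}" "curv_reg e s - curv_reg e t = E' r * (s - t)"
          using mvt[of t s] s t by auto
        then show ?thesis using False s by (intro that[of r]) (auto simp: divide_simps)
      qed
      then have rT: "r \<in> {0..T}" and rd: "dist r t < d" using s t by (auto simp: dist_real_def)
      have "E' r \<le> \<rho> r + C2 * (curv_reg e r - curv r)"
        using E'(2)[OF rT] by (simp add: \<rho>_def algebra_simps)
      also have "curv_reg e r - curv r \<le> e * M"
        using curv_reg_bounds(2)[OF e rT] mult_left_mono[OF M[OF rT], of e] e by linarith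
      then have "\<rho> r + C2 * (curv_reg e r - curv r) \<le> \<rho> r + C2 * (e * M)"
        using C2_nonneg by (intro add_left_mono mult_left_mono)
      also have "\<rho> r \<le> \<rho> t + \<delta>" using d(2)[OF rT rd] by (auto simp: dist_real_def)
      finally show ?thesis using r(2) by (simp add: mult.assoc)
    qed
    have "(curv s - curv t) / (s - t) \<le> \<rho> t + \<delta>"
      if s: "s \<in> {0..T}" "s \<noteq> t" "dist s t < d" for s
    proof (rule tendsto_le)
      have lim: "((\<lambda>e. curv_reg e r) \<longlongrightarrow> curv r) (at_right 0)" if "r \<in> {0..T}" for r
      proof (rule tendsto_sandwich)
        show "\<forall>\<^sub>F e in at_right 0. curv r \<le> curv_reg e r"
          "\<forall>\<^sub>F e in at_right 0. curv_reg e r \<le> curv r + e * len r"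
          using curv_reg_bounds[OF _ that] by (auto simp: eventually_at_right_less[THEN eventually_mono])
        have "((\<lambda>e. curv r + e * len r) \<longlongrightarrow> curv r + 0 * len r) (at_right 0)"
          by (intro tendsto_intros)
        then show "((\<lambda>e. curv r + e * len r) \<longlongrightarrow> curv r) (at_right 0)" by simp
      qed simp
      show "((\<lambda>e. (curv_reg e s - curv_reg e t) / (s - t)) \<longlongrightarrow> (curv s - curv t) / (s - t)) (at_right 0)"
        using lim[OF s(1)] lim[OF t] s(2) by (intro tendsto_intros) auto
      have "((\<lambda>e. \<rho> t + \<delta> + C2 * e * M) \<longlongrightarrow> \<rho> t + \<delta> + C2 * 0 * M) (at_right 0)"
        by (intro tendsto_intros)
      then show "((\<lambda>e. \<rho> t + \<delta> + C2 * e * M) \<longlongrightarrow> \<rho> t + \<delta>) (at_right 0)" by simp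
      show "\<forall>\<^sub>F e in at_right 0. (curv_reg e s - curv_reg e t) / (s - t) \<le> \<rho> t + \<delta> + C2 * e * M"
        using reg[OF s] by (auto simp: eventually_at_right_less[THEN eventually_mono])
    qed simp
    then show ?thesis using d(1) unfolding eventually_at by blast
  qed
  show ?thesis
    unfolding upper_deriv_def \<rho>_def[symmetric]
  proof (rule ereal_le_epsilon2)
    fix \<delta> :: real assume "0 < \<delta>"
    then show "Limsup (at t within {0..T}) (\<lambda>s. ereal ((curv s - curv t) / (s - t))) \<le> ereal (\<rho> t) + ereal \<delta>"
      using main[of \<delta>] by (intro Limsup_bounded) simp
  qed
qed

end

section \<open>Curve-shrinking flow in a chart\<close>

locale flow =
  fixes A :: "('m::topological_space, 'a::euclidean_space) chart set"
    and T :: real and g :: "real \<Rightarrow> ('m, 'a) metric" and c :: "'m curves"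
  assumes atlas: "smooth_atlas A" and T_pos: "0 < T"
    and ricci_flow: "ricci_flow A T g" and shrinking: "curve_shrinking_flow A T g c"
begin

abbreviation "Dom \<kappa> \<equiv> {z \<in> strip T. c z \<in> dom_chart \<kappa>}"
abbreviation "\<phi> \<kappa> z \<equiv> coord \<kappa> (c z)"
abbreviation "X \<kappa> \<equiv> tangent_in \<kappa> c"
abbreviation "S \<kappa> \<equiv> unit_tangent_in \<kappa> g c"
abbreviation "H \<kappa> \<equiv> curvature_in \<kappa> g c"
abbreviation "ST \<kappa> \<equiv> spacetime_metric g \<kappa>"
abbreviation "U \<kappa> \<equiv> img_chart \<kappa>"

lemma immersed: "immersed_curve_family A T c"
  using shrinking by (simp add: curve_shrinking_flow_def)

lemma chart_at: "chart_at A p \<in> A" "p \<in> dom_chart (chart_at A p)"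
proof -
  have "\<exists>\<kappa>. \<kappa> \<in> A \<and> p \<in> dom_chart \<kappa>" using atlas unfolding smooth_atlas_def by blast
  from someI_ex[OF this] show "chart_at A p \<in> A" "p \<in> dom_chart (chart_at A p)"
    by (auto simp: chart_at_def)
qed

lemma open_dom: "\<kappa> \<in> A \<Longrightarrow> open (dom_chart \<kappa>)" and open_U: "\<kappa> \<in> A \<Longrightarrow> open (U \<kappa>)"
  using atlas by (auto simp: smooth_atlas_def)

lemma thick_U: "\<kappa> \<in> A \<Longrightarrow> thick (U \<kappa>)"
  by (intro thick_open open_U)

lemma openin_Dom: "\<kappa> \<in> A \<Longrightarrow> openin (top_of_set (strip T)) (Dom \<kappa>)"
  using continuous_openin_preimage_gen[OF _ open_dom, of "strip T" c] immersed
  by (simp add: immersed_curve_family_def vimage_def Int_def)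

lemma thick_Dom: "\<kappa> \<in> A \<Longrightarrow> thick (Dom \<kappa>)"
  by (rule thick_openin[OF thick_strip[OF T_pos] openin_Dom])

text \<open>Space slices are open, so space derivatives are full two-sided ones. Time slices are
  only relatively open in \<open>{0..T}\<close>, which is why time derivatives stay within that
  interval.\<close>

lemma open_slice:
  assumes "\<kappa> \<in> A" "s \<in> {0..T}"
  shows "open {y. (y, s) \<in> Dom \<kappa>}"
proof -
  obtain W where W: "open W" "Dom \<kappa> = strip T \<inter> W"
    using openin_Dom[OF assms(1)] unfolding openin_open by blast
  have "open ((\<lambda>y. (y, s)) -` W)" by (intro open_vimage W continuous_intros)
  moreover have "(\<lambda>y. (y, s)) -` W = {y. (y, s) \<in> Dom \<kappa>}" unfolding W(2) using assms(2) by auto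
  ultimately show ?thesis by simp
qed

lemma at_within_time_slice:
  assumes "\<kappa> \<in> A" "(x, s) \<in> Dom \<kappa>"
  shows "at s within {r. (x, r) \<in> Dom \<kappa>} = at s within {0..T}"
proof -
  obtain W where W: "open W" "Dom \<kappa> = strip T \<inter> W"
    using openin_Dom[OF assms(1)] unfolding openin_open by blast
  have "open (Pair x -` W)" by (intro open_vimage W continuous_intros)
  moreover have "{r. (x, r) \<in> Dom \<kappa>} = {0..T} \<inter> Pair x -` W" unfolding W(2) by auto
  ultimately have "openin (top_of_set {0..T}) {r. (x, r) \<in> Dom \<kappa>}" by (metis openin_open_Int)
  then show ?thesis by (rule at_within_openin) (use assms(2) in blast)
qed

lemma \<phi>_smooth: "\<kappa> \<in> A \<Longrightarrow> Ck_on n (Dom \<kappa>) (\<phi> \<kappa>)"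
  using immersed by (simp add: immersed_curve_family_def smooth_on_def)

lemma has_derivative_\<phi>:
  "\<kappa> \<in> A \<Longrightarrow> z \<in> Dom \<kappa> \<Longrightarrow>
    (\<phi> \<kappa> has_derivative frechet_derivative (\<phi> \<kappa>) (at z within Dom \<kappa>)) (at z within Dom \<kappa>)"
  using Ck_on_has_derivative[OF \<phi>_smooth] .

lemma space_derivative:
  fixes f :: "real \<times> real \<Rightarrow> 'b::real_normed_vector"
  assumes "\<kappa> \<in> A" "Ck_on (Suc 0) (Dom \<kappa>) f" "(x, s) \<in> Dom \<kappa>"
  shows "((\<lambda>y. f (y, s)) has_vector_derivative frechet_derivative f (at (x, s) within Dom \<kappa>) (1, 0)) (at x)"
proof -
  have "at x within {y. (y, s) \<in> Dom \<kappa>} = at x"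
    by (rule at_within_open[OF _ open_slice[OF assms(1)]]) (use assms(3) in auto)
  then show ?thesis
    using partial_derivatives(1)[OF Ck_on_has_derivative[OF assms(2,3)]] by simp
qed

lemma time_derivative:
  fixes f :: "real \<times> real \<Rightarrow> 'b::real_normed_vector"
  assumes "\<kappa> \<in> A" "Ck_on (Suc 0) (Dom \<kappa>) f" "(x, s) \<in> Dom \<kappa>"
  shows "((\<lambda>r. f (x, r)) has_vector_derivative frechet_derivative f (at (x, s) within Dom \<kappa>) (0, 1)) (at s within {0..T})"
  using partial_derivatives(2)[OF Ck_on_has_derivative[OF assms(2,3)]]
  unfolding at_within_time_slice[OF assms(1,3)] .

lemma X_eq:
  assumes "\<kappa> \<in> A" "z \<in> Dom \<kappa>"
  shows "X \<kappa> z = frechet_derivative (\<phi> \<kappa>) (at z within Dom \<kappa>) (1, 0)"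
proof (cases z)
  case (Pair x s)
  then show ?thesis
    using vector_derivative_at[OF space_derivative[OF assms(1) \<phi>_smooth[OF assms(1)], of x s]] assms(2)
    by (simp add: tangent_in_def)
qed

lemma H_eq:
  assumes "\<kappa> \<in> A" "z \<in> Dom \<kappa>"
  shows "H \<kappa> z = frechet_derivative (\<phi> \<kappa>) (at z within Dom \<kappa>) (0, 1)"
proof (cases z)
  case (Pair x s)
  have "((\<lambda>r. \<phi> \<kappa> (x, r)) has_vector_derivative H \<kappa> (x, s)) (at s within cbox 0 T)"
    using shrinking assms Pair unfolding curve_shrinking_flow_def by auto
  moreover have "((\<lambda>r. \<phi> \<kappa> (x, r)) has_vector_derivative
      frechet_derivative (\<phi> \<kappa>) (at z within Dom \<kappa>) (0, 1)) (at s within cbox 0 T)"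
    using time_derivative[OF assms(1) \<phi>_smooth[OF assms(1)], of x s] assms(2) Pair by simp
  ultimately show ?thesis
    using vector_derivative_unique_within_closed_interval[OF T_pos] assms(2) Pair by auto
qed

lemma X_smooth: "\<kappa> \<in> A \<Longrightarrow> Ck_on n (Dom \<kappa>) (X \<kappa>)"
  by (rule iffD2[OF Ck_on_cong[OF X_eq] Ck_on_partial[OF \<phi>_smooth]])

lemma H_smooth: "\<kappa> \<in> A \<Longrightarrow> Ck_on n (Dom \<kappa>) (H \<kappa>)"
  by (rule iffD2[OF Ck_on_cong[OF H_eq] Ck_on_partial[OF \<phi>_smooth]])

lemma X_time_derivative:
  assumes "\<kappa> \<in> A" "(x, s) \<in> Dom \<kappa>"
  shows "((\<lambda>r. X \<kappa> (x, r)) has_vector_derivative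
    frechet_derivative (H \<kappa>) (at (x, s) within Dom \<kappa>) (1, 0)) (at s within {0..T})"
proof -
  let ?D = "\<lambda>v z. frechet_derivative (\<phi> \<kappa>) (at z within Dom \<kappa>) v"
  have "frechet_derivative (X \<kappa>) (at (x, s) within Dom \<kappa>) = frechet_derivative (?D (1, 0)) (at (x, s) within Dom \<kappa>)"
    by (rule frechet_derivative_cong_on[OF X_eq[OF assms(1)] assms(2)])
  moreover have "frechet_derivative (H \<kappa>) (at (x, s) within Dom \<kappa>) = frechet_derivative (?D (0, 1)) (at (x, s) within Dom \<kappa>)"
    by (rule frechet_derivative_cong_on[OF H_eq[OF assms(1)] assms(2)])
  ultimately show ?thesis
    using time_derivative[OF assms(1) X_smooth[OF assms(1)] assms(2)]
      mixed_partials[OF T_pos openin_Dom[OF assms(1)] \<phi>_smooth[OF assms(1)] assms(2)] by simp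
qed

section \<open>The Ricci flow as a metric on space-time\<close>

lemma metric: "smooth_metric_family A T g"
  using ricci_flow by (simp add: ricci_flow_def)

lemma inner_g: "\<kappa> \<in> A \<Longrightarrow> s \<in> {0..T} \<Longrightarrow> q \<in> U \<kappa> \<Longrightarrow> inner_form (g s \<kappa> q)"
  using metric unfolding smooth_metric_family_def by blast

lemma g_smooth: "\<kappa> \<in> A \<Longrightarrow> Ck_on n (U \<kappa> \<times> {0..T}) (\<lambda>p. g (snd p) \<kappa> (fst p) u v)"
  using metric by (simp add: smooth_metric_family_def smooth_on_def split_def)

lemma thick_UT: "\<kappa> \<in> A \<Longrightarrow> thick (U \<kappa> \<times> {0..T})"
  by (intro thick_Times thick_U thick_Icc T_pos)

text \<open>Smoothness in space and time jointly provides one derivative \<open>F\<close>.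
  Restricting it to the slices recovers the space derivative at a frozen time and, through the flow
  equation, identifies its time component with the Ricci tensor.\<close>

lemma g_has_derivative:
  fixes u v :: 'a
  assumes "\<kappa> \<in> A" "q \<in> U \<kappa>" "s \<in> {0..T}"
  defines "F \<equiv> frechet_derivative (\<lambda>p. g (snd p) \<kappa> (fst p) u v) (at (q, s) within U \<kappa> \<times> {0..T})"
  shows "((\<lambda>p. g (snd p) \<kappa> (fst p) u v) has_derivative F) (at (q, s) within U \<kappa> \<times> {0..T})"
    and "((\<lambda>q. g s \<kappa> q u v) has_derivative (\<lambda>w. F (w, 0))) (at q within U \<kappa>)"
    and "F (0, 1) = - 2 * ricci (U \<kappa>) (g s \<kappa>) q u v"
proof -
  show F: "((\<lambda>p. g (snd p) \<kappa> (fst p) u v) has_derivative F) (at (q, s) within U \<kappa> \<times> {0..T})"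
    unfolding F_def using Ck_on_has_derivative[OF g_smooth[OF assms(1)]] assms(2,3) by blast
  have 1: "((\<lambda>q. (q, s)) has_derivative (\<lambda>w. (w, 0))) (at q within U \<kappa>)"
    by (rule has_derivative_Pair[OF has_derivative_ident has_derivative_const])
  have 2: "((\<lambda>r. (q, r)) has_derivative (\<lambda>h. (0, h))) (at s within {0..T})"
    by (rule has_derivative_Pair[OF has_derivative_const has_derivative_ident])
  have "((\<lambda>p. g (snd p) \<kappa> (fst p) u v) has_derivative F) (at (q, s) within (\<lambda>q. (q, s)) ` U \<kappa>)"
    "((\<lambda>p. g (snd p) \<kappa> (fst p) u v) has_derivative F) (at (q, s) within (\<lambda>r. (q, r)) ` {0..T})"
    by (rule has_derivative_subset[OF F]; use assms(2,3) in auto)+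
  note 3 = has_derivative_in_compose[OF 1 this(1)] has_derivative_in_compose[OF 2 this(2)]
  show "((\<lambda>q. g s \<kappa> q u v) has_derivative (\<lambda>w. F (w, 0))) (at q within U \<kappa>)"
    using 3(1) by simp
  have "F (0, h) = F (0, 1) * h" for h
    using linear_cmul[OF has_derivative_linear[OF F], of h "(0, 1)"] by simp
  then have "(\<lambda>h. F (0, h)) = (*) (F (0, 1))" by (rule ext)
  then have "((\<lambda>r. g r \<kappa> q u v) has_real_derivative F (0, 1)) (at s within {0..T})"
    using 3(2) unfolding has_field_derivative_def by simp
  moreover have "((\<lambda>r. g r \<kappa> q u v) has_real_derivative - 2 * ricci (U \<kappa>) (g s \<kappa>) q u v) (at s within {0..T})"
    using ricci_flow assms(1-3) unfolding ricci_flow_def by blast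
  ultimately show "F (0, 1) = - 2 * ricci (U \<kappa>) (g s \<kappa>) q u v"
    using DERIV_unique_Icc[OF T_pos assms(3)] by blast
qed

lemma metric_field_g: "\<kappa> \<in> A \<Longrightarrow> s \<in> {0..T} \<Longrightarrow> metric_field (U \<kappa>) (g s \<kappa>)"
  by unfold_locales (assumption | rule thick_U inner_g differentiableI[OF g_has_derivative(2)])+

lemma ST_eq: "ST \<kappa> p w w' = g (snd p) \<kappa> (fst p) (fst w) (fst w') + snd w * snd w'"
  by (simp add: spacetime_metric_def split_def)

lemma metric_field_ST:
  assumes "\<kappa> \<in> A"
  shows "metric_field (U \<kappa> \<times> {0..T}) (ST \<kappa>)"
proof
  show "thick (U \<kappa> \<times> {0..T})" by (rule thick_UT[OF assms])
next
  fix p assume p: "p \<in> U \<kappa> \<times> {0..T}"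
  then have "inner_form (\<lambda>(u, a) (v, b). g (snd p) \<kappa> (fst p) u v + a * b)"
    using inner_g[OF assms] by (intro inner_form_prod) auto
  then show "inner_form (ST \<kappa> p)" by (simp add: spacetime_metric_def split_def)
next
  fix p w w' assume "p \<in> U \<kappa> \<times> {0..T}"
  then obtain q s where p: "p = (q, s)" "q \<in> U \<kappa>" "s \<in> {0..T}" by blast
  show "(\<lambda>q. ST \<kappa> q w w') differentiable at p within U \<kappa> \<times> {0..T}"
    unfolding ST_eq p(1)
    by (intro differentiable_add differentiable_const
        differentiableI[OF g_has_derivative(1)[OF assms p(2,3)]])
qed

text \<open>By linearity \<open>(w, r)\<close> splits into \<open>(w, 0)\<close> and
  \<open>r\<close> times \<open>(0, 1)\<close>. The product of the time components in
  \<open>ST\<close> is constant and contributes nothing. This is where Ricci curvature enters the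
  evolution of lengths.\<close>

lemma metric_deriv_ST:
  assumes "\<kappa> \<in> A" "q \<in> U \<kappa>" "s \<in> {0..T}"
  shows "metric_deriv (U \<kappa> \<times> {0..T}) (ST \<kappa>) (q, s) (w, r) (u, 0) (v, 0)
    = metric_deriv (U \<kappa>) (g s \<kappa>) q w u v - 2 * r * ricci (U \<kappa>) (g s \<kappa>) q u v"
proof -
  interpret G: metric_field "U \<kappa>" "g s \<kappa>" by (rule metric_field_g[OF assms(1,3)])
  interpret ST: metric_field "U \<kappa> \<times> {0..T}" "ST \<kappa>" by (rule metric_field_ST[OF assms(1)])
  let ?F = "frechet_derivative (\<lambda>p. g (snd p) \<kappa> (fst p) u v) (at (q, s) within U \<kappa> \<times> {0..T})"
  note F = g_has_derivative[OF assms, of u v]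
  have "metric_deriv (U \<kappa> \<times> {0..T}) (ST \<kappa>) (q, s) (w, r) (u, 0) (v, 0) = ?F (w, r)"
    by (rule ST.metric_deriv_eqI) (use assms F(1) in \<open>auto simp: ST_eq\<close>)
  also have "?F (w, r) = ?F (w, 0) + r * ?F (0, 1)"
    using linear_add[OF has_derivative_linear[OF F(1)], of "(w, 0)" "r *\<^sub>R (0, 1)"]
      linear_cmul[OF has_derivative_linear[OF F(1)], of r "(0, 1)"] by simp
  also have "?F (w, 0) = metric_deriv (U \<kappa>) (g s \<kappa>) q w u v"
    by (rule G.metric_deriv_eqI[OF assms(2) F(2), symmetric])
  finally show ?thesis using F(3) by simp
qed

text \<open>Bilinearity is read off the flow equation; proving it from the definition of \<open>ricci\<close> would
  require the differentiability of the Christoffel map.\<close>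

lemma ricci_bilinear:
  assumes "\<kappa> \<in> A" "q \<in> U \<kappa>" "s \<in> {0..T}"
  shows "bilinear (ricci (U \<kappa>) (g s \<kappa>) q)"
proof -
  interpret ST: metric_field "U \<kappa> \<times> {0..T}" "ST \<kappa>" by (rule metric_field_ST[OF assms(1)])
  interpret G: metric_field "U \<kappa>" "g s \<kappa>" by (rule metric_field_g[OF assms(1,3)])
  let ?B = "metric_deriv (U \<kappa> \<times> {0..T}) (ST \<kappa>) (q, s) (0, 1)"
  have B: "bilinear ?B" by (rule ST.metric_deriv_bilinear) (use assms in simp)
  have "metric_deriv (U \<kappa>) (g s \<kappa>) q 0 u v = 0" for u v
    using linear_0[OF G.metric_deriv_linear[OF assms(2)]] by simp
  then have R: "ricci (U \<kappa>) (g s \<kappa>) q u v = - ?B (u, 0) (v, 0) / 2" for u v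
    using metric_deriv_ST[OF assms, of 0 1 u v] by simp
  have add: "(u + u', 0) = (u, 0) + (u', 0 :: real)" and mul: "(r *\<^sub>R u, 0) = r *\<^sub>R (u, 0 :: real)"
    for u u' :: 'a and r by simp_all
  show ?thesis
    unfolding bilinear_def R add mul
    by (auto intro!: linearI simp: bilinear_ladd[OF B] bilinear_radd[OF B] bilinear_lmul[OF B]
        bilinear_rmul[OF B] add mul field_simps simp del: add_Pair scaleR_Pair)
qed

text \<open>Composition is available for real-valued outer functions, so the form is expanded in
  \<open>Basis\<close> and its components are composed with the space-time curve.\<close>

lemma g_along_smooth:
  assumes \<kappa>: "\<kappa> \<in> A" and V: "Ck_on n (Dom \<kappa>) V"
  shows "Ck_on n (Dom \<kappa>) (\<lambda>z. g (snd z) \<kappa> (\<phi> \<kappa> z) (V z) (V z))"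
proof -
  note th = thick_Dom[OF \<kappa>]
  have pair: "Ck_on n (Dom \<kappa>) (\<lambda>z. (\<phi> \<kappa> z, snd z))"
  proof -
    have "Ck_on n (Dom \<kappa>) (\<lambda>z. z)"
      using Ck_on_id[OF th] .
    then have "Ck_on n (Dom \<kappa>) (\<lambda>z. (0, snd z) :: 'a \<times> real)"
      by (rule Ck_on_bounded_linear[OF th, rotated]) (intro bounded_linear_intros)
    moreover have "Ck_on n (Dom \<kappa>) (\<lambda>z. (\<phi> \<kappa> z, 0) :: 'a \<times> real)"
      by (rule Ck_on_bounded_linear[OF th _ \<phi>_smooth[OF \<kappa>]]) (intro bounded_linear_intros)
    ultimately show ?thesis using Ck_on_add[OF th] by fastforce
  qed
  have "Ck_on n (Dom \<kappa>) (\<lambda>z. g (snd (\<phi> \<kappa> z, snd z)) \<kappa> (fst (\<phi> \<kappa> z, snd z)) i j)" for i j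
    by (rule Ck_on_compose[OF th _ g_smooth[OF \<kappa>] pair]) auto
  moreover have "Ck_on n (Dom \<kappa>) (\<lambda>z. V z \<bullet> i)" for i
    by (rule Ck_on_bounded_linear[OF th bounded_linear_inner_left V])
  ultimately have "Ck_on n (Dom \<kappa>) (\<lambda>z. \<Sum>i\<in>Basis. \<Sum>j\<in>Basis. (V z \<bullet> i) * (V z \<bullet> j) * g (snd z) \<kappa> (\<phi> \<kappa> z) i j)"
    by (intro Ck_on_sum Ck_on_mult th) auto
  moreover have "g (snd z) \<kappa> (\<phi> \<kappa> z) (V z) (V z) =
      (\<Sum>i\<in>Basis. \<Sum>j\<in>Basis. (V z \<bullet> i) * (V z \<bullet> j) * g (snd z) \<kappa> (\<phi> \<kappa> z) i j)" if "z \<in> Dom \<kappa>" for z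
    by (rule bilinear_Basis_expand[OF inner_formD(1)[OF inner_g[OF \<kappa>]]]) (use that in auto)
  ultimately show ?thesis by (subst Ck_on_cong) auto
qed

section \<open>Independence of the chart\<close>

text \<open>Both vectors are partial derivatives of the coordinate map of the flow, so one
  application of the chain rule to the change of charts transforms them. No transformation law for
  Christoffel symbols is involved.\<close>

lemma \<phi>_transition:
  assumes \<kappa>: "\<kappa> \<in> A" and \<mu>: "\<mu> \<in> A" and z: "z \<in> Dom \<kappa>" "z \<in> Dom \<mu>"
  defines "\<tau> \<equiv> frechet_derivative (transition \<kappa> \<mu>) (at (\<phi> \<kappa> z))"
  shows "X \<mu> z = \<tau> (X \<kappa> z)" "H \<mu> z = \<tau> (H \<kappa> z)"
proof -
  let ?W = "coord \<kappa> ` (dom_chart \<kappa> \<inter> dom_chart \<mu>)" and ?D = "Dom \<kappa> \<inter> Dom \<mu>"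
  obtain \<psi> where \<psi>: "homeomorphism (dom_chart \<kappa>) (U \<kappa>) (coord \<kappa>) \<psi>"
    using atlas \<kappa> unfolding smooth_atlas_def by blast
  have "openin (top_of_set (dom_chart \<kappa>)) (dom_chart \<kappa> \<inter> dom_chart \<mu>)"
    using open_dom[OF \<mu>] by (rule openin_open_Int)
  then have "openin (top_of_set (U \<kappa>)) ?W" by (rule homeomorphism_imp_open_map[OF \<psi>])
  then have W: "open ?W" using open_U[OF \<kappa>] openin_open_trans by blast
  have inj: "inj_on (coord \<kappa>) (dom_chart \<kappa>)" by (rule inj_on_inverseI) (use \<psi> in \<open>auto simp: homeomorphism_def\<close>)
  have tr: "\<phi> \<mu> w = transition \<kappa> \<mu> (\<phi> \<kappa> w)" if "w \<in> ?D" for w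
    using that by (simp add: transition_def inv_into_f_f[OF inj])
  have "Ck_on (Suc 0) ?W (transition \<kappa> \<mu>)"
    using atlas \<kappa> \<mu> unfolding smooth_atlas_def smooth_on_def by blast
  then have "transition \<kappa> \<mu> differentiable (at (\<phi> \<kappa> z) within ?W)"
    using z by (auto simp: differentiable_on_def)
  moreover have "at (\<phi> \<kappa> z) within ?W = at (\<phi> \<kappa> z)"
    by (rule at_within_open[OF _ W]) (use z in auto)
  ultimately have \<tau>: "(transition \<kappa> \<mu> has_derivative \<tau>) (at (\<phi> \<kappa> z))"
    unfolding \<tau>_def by (simp add: frechet_derivative_works)
  have D: "openin (top_of_set (strip T)) ?D" using openin_Int openin_Dom \<kappa> \<mu> by blast
  have zD: "z \<in> ?D" using z by blast
  \<comment> \<open>The two coordinate maps live on different domains; near \<open>z\<close> both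
    domains agree with their intersection as far as derivatives are concerned.\<close>
  have w: "at z within Dom \<kappa> = at z within ?D" "at z within Dom \<mu> = at z within ?D"
    using at_within_openin[OF D zD] at_within_openin[OF openin_Dom[OF \<kappa>] z(1)]
      at_within_openin[OF openin_Dom[OF \<mu>] z(2)] by simp_all
  have "((\<lambda>w. transition \<kappa> \<mu> (\<phi> \<kappa> w)) has_derivative
      (\<lambda>h. \<tau> (frechet_derivative (\<phi> \<kappa>) (at z within Dom \<kappa>) h))) (at z within ?D)"
    using has_derivative_compose[OF has_derivative_\<phi>[OF \<kappa> z(1)] \<tau>] unfolding w(1) .
  then have "(\<phi> \<mu> has_derivative (\<lambda>h. \<tau> (frechet_derivative (\<phi> \<kappa>) (at z within Dom \<kappa>) h))) (at z within Dom \<mu>)"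
    unfolding w(2) by (rule has_derivative_transform[OF zD tr, rotated])
  then have "frechet_derivative (\<phi> \<mu>) (at z within Dom \<mu>) =
      (\<lambda>h. \<tau> (frechet_derivative (\<phi> \<kappa>) (at z within Dom \<kappa>) h))"
    by (rule thick_frechet_derivative[OF thick_Dom[OF \<mu>] z(2)])
  then show "X \<mu> z = \<tau> (X \<kappa> z)" "H \<mu> z = \<tau> (H \<kappa> z)"
    by (simp_all add: X_eq[OF \<kappa> z(1)] X_eq[OF \<mu> z(2)] H_eq[OF \<kappa> z(1)] H_eq[OF \<mu> z(2)])
qed

lemma chart_independent:
  assumes \<kappa>: "\<kappa> \<in> A" and \<mu>: "\<mu> \<in> A" and z: "z \<in> Dom \<kappa>" "z \<in> Dom \<mu>"
  shows "g (snd z) \<kappa> (\<phi> \<kappa> z) (X \<kappa> z) (X \<kappa> z) = g (snd z) \<mu> (\<phi> \<mu> z) (X \<mu> z) (X \<mu> z)"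
    and "g (snd z) \<kappa> (\<phi> \<kappa> z) (H \<kappa> z) (H \<kappa> z) = g (snd z) \<mu> (\<phi> \<mu> z) (H \<mu> z) (H \<mu> z)"
proof -
  obtain \<psi> where \<psi>: "homeomorphism (dom_chart \<kappa>) (U \<kappa>) (coord \<kappa>) \<psi>"
    using atlas \<kappa> unfolding smooth_atlas_def by blast
  have inj: "inj_on (coord \<kappa>) (dom_chart \<kappa>)" by (rule inj_on_inverseI) (use \<psi> in \<open>auto simp: homeomorphism_def\<close>)
  have tr: "transition \<kappa> \<mu> (\<phi> \<kappa> z) = \<phi> \<mu> z"
    using z by (simp add: transition_def inv_into_f_f[OF inj])
  have "g (snd z) \<kappa> (\<phi> \<kappa> z) u v = g (snd z) \<mu> (transition \<kappa> \<mu> (\<phi> \<kappa> z))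
      (frechet_derivative (transition \<kappa> \<mu>) (at (\<phi> \<kappa> z)) u)
      (frechet_derivative (transition \<kappa> \<mu>) (at (\<phi> \<kappa> z)) v)" for u v
  proof -
    have "snd z \<in> {0..T}" "\<phi> \<kappa> z \<in> coord \<kappa> ` (dom_chart \<kappa> \<inter> dom_chart \<mu>)" using z by auto
    then show ?thesis using metric \<kappa> \<mu> unfolding smooth_metric_family_def by blast
  qed
  then show "g (snd z) \<kappa> (\<phi> \<kappa> z) (X \<kappa> z) (X \<kappa> z) = g (snd z) \<mu> (\<phi> \<mu> z) (X \<mu> z) (X \<mu> z)"
    "g (snd z) \<kappa> (\<phi> \<kappa> z) (H \<kappa> z) (H \<kappa> z) = g (snd z) \<mu> (\<phi> \<mu> z) (H \<mu> z) (H \<mu> z)"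
    unfolding \<phi>_transition[OF \<kappa> \<mu> z] tr by blast+
qed

definition "P z = (speed A g c z)\<^sup>2"
definition "K z = (curvature A g c z)\<^sup>2"

text \<open>The chart picked by \<open>chart_at\<close> may jump from point to point. Smoothness of
  \<open>P\<close> and \<open>K\<close> can only be seen from a formula in one chart valid
  throughout its domain.\<close>

lemma P_eq: "\<kappa> \<in> A \<Longrightarrow> z \<in> Dom \<kappa> \<Longrightarrow> P z = g (snd z) \<kappa> (\<phi> \<kappa> z) (X \<kappa> z) (X \<kappa> z)"
  and K_eq: "\<kappa> \<in> A \<Longrightarrow> z \<in> Dom \<kappa> \<Longrightarrow> K z = g (snd z) \<kappa> (\<phi> \<kappa> z) (H \<kappa> z) (H \<kappa> z)"
proof -
  let ?\<mu> = "chart_at A (c z)"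
  assume \<kappa>: "\<kappa> \<in> A" and z: "z \<in> Dom \<kappa>"
  then have \<mu>: "?\<mu> \<in> A" "z \<in> Dom ?\<mu>" using chart_at by auto
  have "0 \<le> g (snd z) ?\<mu> (\<phi> ?\<mu> z) V V" for V
    by (rule inner_formD(4)[OF inner_g[OF \<mu>(1)]]) (use \<mu>(2) in auto)
  then have "P z = g (snd z) ?\<mu> (\<phi> ?\<mu> z) (X ?\<mu> z) (X ?\<mu> z)"
    "K z = g (snd z) ?\<mu> (\<phi> ?\<mu> z) (H ?\<mu> z) (H ?\<mu> z)"
    by (simp_all add: P_def K_def speed_def curvature_def length_in_def Let_def split_def)
  then show "P z = g (snd z) \<kappa> (\<phi> \<kappa> z) (X \<kappa> z) (X \<kappa> z)" "K z = g (snd z) \<kappa> (\<phi> \<kappa> z) (H \<kappa> z) (H \<kappa> z)"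
    unfolding chart_independent[OF \<kappa> \<mu>(1) z \<mu>(2)] .
qed

lemma P_smooth: "Ck_on n (strip T) P" and K_smooth: "Ck_on n (strip T) K"
proof -
  have chart: "chart_at A (c z) \<in> A" "z \<in> Dom (chart_at A (c z))" if "z \<in> strip T" for z
    using chart_at that by auto
  note iff_P = Ck_on_cong[OF P_eq] and iff_K = Ck_on_cong[OF K_eq]
  show "Ck_on n (strip T) P"
    by (rule Ck_on_glue, rule exI, intro conjI, erule chart(2), rule openin_Dom, erule chart(1),
        rule iffD2[OF iff_P g_along_smooth[OF _ X_smooth]]) (simp_all add: chart)
  show "Ck_on n (strip T) K"
    by (rule Ck_on_glue, rule exI, intro conjI, erule chart(2), rule openin_Dom, erule chart(1),
        rule iffD2[OF iff_K g_along_smooth[OF _ H_smooth]]) (simp_all add: chart)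
qed

lemma strip_chart:
  assumes "z \<in> strip T"
  shows "chart_at A (c z) \<in> A" "z \<in> Dom (chart_at A (c z))"
  using chart_at assms by auto

lemma P_pos:
  assumes "z \<in> strip T"
  shows "0 < P z"
proof -
  let ?\<kappa> = "chart_at A (c z)"
  note \<kappa> = strip_chart[OF assms]
  have "X ?\<kappa> z \<noteq> 0"
    using immersed \<kappa> unfolding immersed_curve_family_def by blast
  then show ?thesis
    unfolding P_eq[OF \<kappa>] using \<kappa>(2) by (intro inner_formD(3)[OF inner_g[OF \<kappa>(1)]]) auto
qed

section \<open>Unit tangent and evolution of the length element\<close>

lemma length_X: "\<kappa> \<in> A \<Longrightarrow> z \<in> Dom \<kappa> \<Longrightarrow> length_in \<kappa> g c (X \<kappa>) z = sqrt (P z)"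
  by (simp add: P_eq length_in_def split_def)

lemma S_eq: "\<kappa> \<in> A \<Longrightarrow> z \<in> Dom \<kappa> \<Longrightarrow> S \<kappa> z = X \<kappa> z /\<^sub>R sqrt (P z)"
  by (simp add: unit_tangent_in_def length_X)

lemma X_eq_S: "\<kappa> \<in> A \<Longrightarrow> z \<in> Dom \<kappa> \<Longrightarrow> X \<kappa> z = sqrt (P z) *\<^sub>R S \<kappa> z"
  using P_pos[of z] by (simp add: S_eq)

lemma S_unit:
  assumes \<kappa>: "\<kappa> \<in> A" and z: "z \<in> Dom \<kappa>"
  shows "g (snd z) \<kappa> (\<phi> \<kappa> z) (S \<kappa> z) (S \<kappa> z) = 1"
proof -
  have "bilinear (g (snd z) \<kappa> (\<phi> \<kappa> z))"
    by (rule inner_formD(1)[OF inner_g[OF \<kappa>]]) (use z in auto)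
  moreover have "0 < P z" using P_pos z by blast
  moreover have "inverse (sqrt p) * (inverse (sqrt p) * p) = 1" if "0 < p" for p
    using that by (simp add: field_simps)
  ultimately show ?thesis
    by (simp add: S_eq[OF \<kappa> z] bilinear_lmul bilinear_rmul P_eq[OF \<kappa> z, symmetric])
qed

lemma S_derivative:
  assumes \<kappa>: "\<kappa> \<in> A" and z: "(x, s) \<in> Dom \<kappa>"
  shows "((\<lambda>y. S \<kappa> (y, s)) has_vector_derivative vector_derivative (\<lambda>y. S \<kappa> (y, s)) (at x)) (at x)"
proof -
  have s: "s \<in> {0..T}" using z by auto
  have pos: "0 < P (x, s)" using P_pos s by auto
  have "((\<lambda>y. sqrt (P (y, s))) has_real_derivative inverse (sqrt (P (x, s))) / 2 * dx T P (x, s)) (at x)"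
    by (rule DERIV_sqrt_comp[OF dx_dt(1)[OF P_smooth s] pos])
  from DERIV_inverse'[OF this] obtain d where
    "((\<lambda>y. inverse (sqrt (P (y, s)))) has_real_derivative d) (at x)"
    using pos by auto
  from has_vector_derivative_scaleR[OF this space_derivative[OF \<kappa> X_smooth[OF \<kappa>] z]]
  have "((\<lambda>y. S \<kappa> (y, s)) has_vector_derivative
      inverse (sqrt (P (x, s))) *\<^sub>R frechet_derivative (X \<kappa>) (at (x, s) within Dom \<kappa>) (1, 0) + d *\<^sub>R X \<kappa> (x, s)) (at x)"
    by (rule has_vector_derivative_transform_within_open[OF _ open_slice[OF \<kappa> s]])
      (use z in \<open>auto simp: S_eq[OF \<kappa>]\<close>)
  then show ?thesis unfolding vector_derivative_works[symmetric] by (rule differentiableI_vector)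
qed

text \<open>At a frozen time \<open>s\<close>, the slice of the flow in a chart is a curve to which
  \<open>curvature_orthogonal\<close> and \<open>first_variation\<close> apply, with
  \<open>v = sqrt P\<close>. The Ricci term is absent because the metric does not move here.\<close>

lemma curve_geometry:
  assumes \<kappa>: "\<kappa> \<in> A" and z: "(x, s) \<in> Dom \<kappa>"
  shows "g s \<kappa> (\<phi> \<kappa> (x, s)) (H \<kappa> (x, s)) (S \<kappa> (x, s)) = 0"
    and "metric_deriv (U \<kappa>) (g s \<kappa>) (\<phi> \<kappa> (x, s)) (H \<kappa> (x, s)) (X \<kappa> (x, s)) (X \<kappa> (x, s))
      + 2 * g s \<kappa> (\<phi> \<kappa> (x, s)) (frechet_derivative (H \<kappa>) (at (x, s) within Dom \<kappa>) (1, 0)) (X \<kappa> (x, s))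
      = - 2 * P (x, s) * K (x, s)"
proof -
  have s: "s \<in> {0..T}" using z by auto
  interpret G: metric_field "U \<kappa>" "g s \<kappa>" by (rule metric_field_g[OF \<kappa> s])
  let ?I = "{y. (y, s) \<in> Dom \<kappa>}"
  have curve:
    "open ?I"
    "(\<lambda>y. \<phi> \<kappa> (y, s)) ` ?I \<subseteq> U \<kappa>"
    "\<And>y. y \<in> ?I \<Longrightarrow> ((\<lambda>y. \<phi> \<kappa> (y, s)) has_vector_derivative X \<kappa> (y, s)) (at y)"
    "\<And>y. y \<in> ?I \<Longrightarrow> ((\<lambda>y. S \<kappa> (y, s)) has_vector_derivative vector_derivative (\<lambda>y. S \<kappa> (y, s)) (at y)) (at y)"
    "\<And>y. y \<in> ?I \<Longrightarrow> X \<kappa> (y, s) = sqrt (P (y, s)) *\<^sub>R S \<kappa> (y, s)"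
    "\<And>y. y \<in> ?I \<Longrightarrow> 0 < sqrt (P (y, s))"
    "\<And>y. y \<in> ?I \<Longrightarrow> g s \<kappa> (\<phi> \<kappa> (y, s)) (S \<kappa> (y, s)) (S \<kappa> (y, s)) = 1"
    "\<And>y. y \<in> ?I \<Longrightarrow> H \<kappa> (y, s) =
      cov_deriv_along (U \<kappa>) (g s \<kappa>) (\<lambda>y. \<phi> \<kappa> (y, s)) (\<lambda>y. S \<kappa> (y, s)) y /\<^sub>R sqrt (P (y, s))"
  proof -
    show "open ?I" by (rule open_slice[OF \<kappa> s])
    show "(\<lambda>y. \<phi> \<kappa> (y, s)) ` ?I \<subseteq> U \<kappa>" by auto
    fix y assume "y \<in> ?I"
    then have y: "(y, s) \<in> Dom \<kappa>" by blast
    show "((\<lambda>y. \<phi> \<kappa> (y, s)) has_vector_derivative X \<kappa> (y, s)) (at y)"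
      unfolding X_eq[OF \<kappa> y] by (rule space_derivative[OF \<kappa> \<phi>_smooth[OF \<kappa>] y])
    show "((\<lambda>y. S \<kappa> (y, s)) has_vector_derivative vector_derivative (\<lambda>y. S \<kappa> (y, s)) (at y)) (at y)"
      by (rule S_derivative[OF \<kappa> y])
    show "X \<kappa> (y, s) = sqrt (P (y, s)) *\<^sub>R S \<kappa> (y, s)" by (rule X_eq_S[OF \<kappa> y])
    show "0 < sqrt (P (y, s))" using P_pos[of "(y, s)"] s by simp
    show "g s \<kappa> (\<phi> \<kappa> (y, s)) (S \<kappa> (y, s)) (S \<kappa> (y, s)) = 1" using S_unit[OF \<kappa> y] by simp
    show "H \<kappa> (y, s) =
      cov_deriv_along (U \<kappa>) (g s \<kappa>) (\<lambda>y. \<phi> \<kappa> (y, s)) (\<lambda>y. S \<kappa> (y, s)) y /\<^sub>R sqrt (P (y, s))"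
      using length_X[OF \<kappa> y] by (simp add: curvature_in_def)
  qed
  have x: "x \<in> ?I" using z by blast
  show "g s \<kappa> (\<phi> \<kappa> (x, s)) (H \<kappa> (x, s)) (S \<kappa> (x, s)) = 0"
    by (rule G.curvature_orthogonal[OF curve x, unfolded mem_Collect_eq])
  have "metric_deriv (U \<kappa>) (g s \<kappa>) (\<phi> \<kappa> (x, s)) (H \<kappa> (x, s)) (X \<kappa> (x, s)) (X \<kappa> (x, s))
      + 2 * g s \<kappa> (\<phi> \<kappa> (x, s)) (frechet_derivative (H \<kappa>) (at (x, s) within Dom \<kappa>) (1, 0)) (X \<kappa> (x, s))
      = - 2 * (sqrt (P (x, s)))\<^sup>2 * g s \<kappa> (\<phi> \<kappa> (x, s)) (H \<kappa> (x, s)) (H \<kappa> (x, s))"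
    by (rule G.first_variation[OF curve x space_derivative[OF \<kappa> H_smooth[OF \<kappa>] z]])
  moreover have "(sqrt (P (x, s)))\<^sup>2 = P (x, s)" using P_pos[of "(x, s)"] s by simp
  ultimately show "metric_deriv (U \<kappa>) (g s \<kappa>) (\<phi> \<kappa> (x, s)) (H \<kappa> (x, s)) (X \<kappa> (x, s)) (X \<kappa> (x, s))
      + 2 * g s \<kappa> (\<phi> \<kappa> (x, s)) (frechet_derivative (H \<kappa>) (at (x, s) within Dom \<kappa>) (1, 0)) (X \<kappa> (x, s))
      = - 2 * P (x, s) * K (x, s)"
    using K_eq[OF \<kappa> z] by simp
qed

text \<open>The product rule in space-time is applied to the field \<open>(X, 0)\<close> along the
  time curve through a fixed \<open>x\<close>, whose velocity is \<open>(H, 1)\<close>. The time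
  part of the velocity gives the Ricci term; the space part, together with the change of
  \<open>X\<close> at the rate of the \<open>x\<close>-derivative of \<open>H\<close>, is the first
  variation.\<close>

lemma P_evolution_eq:
  assumes \<kappa>: "\<kappa> \<in> A" and z: "(x, s) \<in> Dom \<kappa>"
  shows "dt T P (x, s) = - 2 * ricci (U \<kappa>) (g s \<kappa>) (\<phi> \<kappa> (x, s)) (X \<kappa> (x, s)) (X \<kappa> (x, s))
    - 2 * P (x, s) * K (x, s)"
proof -
  have s: "s \<in> {0..T}" using z by auto
  have q: "\<phi> \<kappa> (x, s) \<in> U \<kappa>" using z by auto
  interpret ST: metric_field "U \<kappa> \<times> {0..T}" "ST \<kappa>" by (rule metric_field_ST[OF \<kappa>])
  let ?J = "{r. (x, r) \<in> Dom \<kappa>}" and ?Hx = "frechet_derivative (H \<kappa>) (at (x, s) within Dom \<kappa>) (1, 0)"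
  note slice = at_within_time_slice[OF \<kappa> z]
  have sJ: "s \<in> ?J" using z by blast
  have \<phi>: "((\<lambda>r. \<phi> \<kappa> (x, r)) has_vector_derivative H \<kappa> (x, s)) (at s within ?J)"
    unfolding slice H_eq[OF \<kappa> z] by (rule time_derivative[OF \<kappa> \<phi>_smooth[OF \<kappa>] z])
  have \<gamma>: "((\<lambda>r. (\<phi> \<kappa> (x, r), r)) has_vector_derivative (H \<kappa> (x, s), 1)) (at s within ?J)"
    by (rule has_vector_derivative_Pair[OF \<phi> has_vector_derivative_id])
  have V: "((\<lambda>r. (X \<kappa> (x, r), 0 :: real)) has_vector_derivative (?Hx, 0)) (at s within ?J)"
    unfolding slice by (rule has_vector_derivative_Pair[OF X_time_derivative[OF \<kappa> z] has_vector_derivative_const])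
  have D: "(\<lambda>r. (\<phi> \<kappa> (x, r), r)) ` ?J \<subseteq> U \<kappa> \<times> {0..T}" by auto
  have "((\<lambda>r. ST \<kappa> (\<phi> \<kappa> (x, r), r) (X \<kappa> (x, r), 0) (X \<kappa> (x, r), 0)) has_real_derivative
      metric_deriv (U \<kappa> \<times> {0..T}) (ST \<kappa>) (\<phi> \<kappa> (x, s), s) (H \<kappa> (x, s), 1) (X \<kappa> (x, s), 0) (X \<kappa> (x, s), 0)
      + ST \<kappa> (\<phi> \<kappa> (x, s), s) (?Hx, 0) (X \<kappa> (x, s), 0) + ST \<kappa> (\<phi> \<kappa> (x, s), s) (X \<kappa> (x, s), 0) (?Hx, 0)) (at s within ?J)"
    by (rule ST.has_derivative_along[OF sJ D \<gamma> V V])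
  also have "ST \<kappa> (\<phi> \<kappa> (x, s), s) (X \<kappa> (x, s), 0) (?Hx, 0) = ST \<kappa> (\<phi> \<kappa> (x, s), s) (?Hx, 0) (X \<kappa> (x, s), 0)"
    by (rule ST.sym) (use q s in simp)
  also have "metric_deriv (U \<kappa> \<times> {0..T}) (ST \<kappa>) (\<phi> \<kappa> (x, s), s) (H \<kappa> (x, s), 1) (X \<kappa> (x, s), 0) (X \<kappa> (x, s), 0)
      + ST \<kappa> (\<phi> \<kappa> (x, s), s) (?Hx, 0) (X \<kappa> (x, s), 0) + ST \<kappa> (\<phi> \<kappa> (x, s), s) (?Hx, 0) (X \<kappa> (x, s), 0)
      = - 2 * ricci (U \<kappa>) (g s \<kappa>) (\<phi> \<kappa> (x, s)) (X \<kappa> (x, s)) (X \<kappa> (x, s)) - 2 * P (x, s) * K (x, s)"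
    using curve_geometry(2)[OF \<kappa> z] by (simp add: metric_deriv_ST[OF \<kappa> q s] ST_eq)
  finally have *: "((\<lambda>r. ST \<kappa> (\<phi> \<kappa> (x, r), r) (X \<kappa> (x, r), 0) (X \<kappa> (x, r), 0)) has_real_derivative
      - 2 * ricci (U \<kappa>) (g s \<kappa>) (\<phi> \<kappa> (x, s)) (X \<kappa> (x, s)) (X \<kappa> (x, s)) - 2 * P (x, s) * K (x, s)) (at s within ?J)" .
  have "((\<lambda>r. P (x, r)) has_real_derivative
      - 2 * ricci (U \<kappa>) (g s \<kappa>) (\<phi> \<kappa> (x, s)) (X \<kappa> (x, s)) (X \<kappa> (x, s)) - 2 * P (x, s) * K (x, s)) (at s within ?J)"
    unfolding has_field_derivative_def
  proof (rule has_derivative_transform[OF sJ _ *[unfolded has_field_derivative_def]])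
    show "P (x, r) = ST \<kappa> (\<phi> \<kappa> (x, r), r) (X \<kappa> (x, r), 0) (X \<kappa> (x, r), 0)" if "r \<in> ?J" for r
      using P_eq[OF \<kappa>, of "(x, r)"] that by (simp add: ST_eq)
  qed
  then show ?thesis
    unfolding slice by (rule DERIV_unique_Icc[OF T_pos s dx_dt(2)[OF P_smooth s]])
qed

lemma P_evolution:
  assumes z: "z \<in> strip T" and Ric: "ricci_norm A g (snd z) (c z) \<le> C2"
  shows "dt T P z \<le> 2 * P z * (C2 - K z)"
proof -
  obtain x s where xs: "z = (x, s)" by fastforce
  let ?\<kappa> = "chart_at A (c z)"
  note \<kappa> = strip_chart[OF z]
  have s: "s \<in> {0..T}" and q: "\<phi> ?\<kappa> z \<in> U ?\<kappa>" using z xs \<kappa> by auto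
  let ?R = "ricci (U ?\<kappa>) (g s ?\<kappa>) (\<phi> ?\<kappa> z)"
  note bil = ricci_bilinear[OF \<kappa>(1) q s]
  have "\<bar>?R (S ?\<kappa> z) (S ?\<kappa> z)\<bar> \<le> tensor_norm (g s ?\<kappa> (\<phi> ?\<kappa> z)) ?R"
    using S_unit[OF \<kappa>] by (intro abs_le_tensor_norm inner_g \<kappa> s q bil) (simp add: xs)
  also have "\<dots> \<le> C2" using Ric by (simp add: ricci_norm_def Let_def xs)
  finally have "- ?R (S ?\<kappa> z) (S ?\<kappa> z) \<le> C2" by simp
  then have "2 * P z * (- ?R (S ?\<kappa> z) (S ?\<kappa> z)) \<le> 2 * P z * C2"
    using P_pos[OF z] by (intro mult_left_mono) auto
  moreover have "?R (X ?\<kappa> z) (X ?\<kappa> z) = P z * ?R (S ?\<kappa> z) (S ?\<kappa> z)"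
    using P_pos[OF z] by (simp add: X_eq_S[OF \<kappa>] bilinear_lmul[OF bil] bilinear_rmul[OF bil])
  ultimately show ?thesis
    using P_evolution_eq[OF \<kappa>(1), of x s] \<kappa>(2) unfolding xs[symmetric]
    by (simp add: algebra_simps)
qed

section \<open>Gradient of the squared curvature\<close>

abbreviation "N \<equiv> normal_cov_curvature_sq A T g c"

text \<open>Metric compatibility of the space-time connection gives the \<open>x\<close>-derivative
  of \<open>K\<close> as twice the pairing of \<open>W0\<close> with \<open>(H, 0)\<close>.
  Cauchy-Schwarz is applied in the full space-time inner product, so the possible time component of
  the derivative is accounted for in \<open>N\<close>.\<close>

lemma K_gradient_N:
  assumes z: "z \<in> strip T"
  shows "(dx T K z)\<^sup>2 \<le> 4 * P z * (N z * K z)" "0 \<le> N z"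
proof -
  obtain x s where xs: "z = (x, s)" by fastforce
  define \<kappa> where "\<kappa> = chart_at A (c z)"
  have \<kappa>: "\<kappa> \<in> A" "z \<in> Dom \<kappa>" unfolding \<kappa>_def using strip_chart[OF z] by auto
  have s: "s \<in> {0..T}" and q: "\<phi> \<kappa> z \<in> U \<kappa>" using z xs \<kappa> by auto
  interpret ST: metric_field "U \<kappa> \<times> {0..T}" "ST \<kappa>" by (rule metric_field_ST[OF \<kappa>(1)])
  let ?I = "{y. (y, s) \<in> Dom \<kappa>}"
  define ip where "ip = ST \<kappa> (\<phi> \<kappa> z, s)"
  have ip: "inner_form ip" unfolding ip_def by (rule ST.inner) (use q s in simp)
  note bil = inner_formD(1)[OF ip]
  define W where "W = spacetime_cov_curvature_in \<kappa> T g c z"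
  define W0 where "W0 = cov_deriv_along (U \<kappa> \<times> {0..T}) (ST \<kappa>) (\<lambda>y. (\<phi> \<kappa> (y, s), s)) (\<lambda>y. (H \<kappa> (y, s), 0)) x"
  define n where "n = W - ip W (S \<kappa> z, 0) *\<^sub>R (S \<kappa> z, 0)"
  define h where "h = (H \<kappa> z, 0 :: real)"
  have N: "N z = ip n n"
    unfolding n_def W_def ip_def \<kappa>_def by (simp add: normal_cov_curvature_sq_def Let_def xs)
  then show "0 \<le> N z" using inner_formD(4)[OF ip] by simp
  have K: "K z = ip h h" using K_eq[OF \<kappa>] by (simp add: ip_def h_def ST_eq xs)
  have W: "W0 = sqrt (P z) *\<^sub>R W"
    using length_X[OF \<kappa>] P_pos[OF z] by (simp add: W_def W0_def spacetime_cov_curvature_in_def xs)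
  have x: "x \<in> ?I" using \<kappa>(2) xs by blast
  have D: "(\<lambda>y. (\<phi> \<kappa> (y, s), s)) ` ?I \<subseteq> U \<kappa> \<times> {0..T}" by auto
  have \<gamma>: "((\<lambda>y. (\<phi> \<kappa> (y, s), s)) has_vector_derivative (X \<kappa> (x, s), 0)) (at x)"
    using space_derivative[OF \<kappa>(1) \<phi>_smooth[OF \<kappa>(1)], of x s] \<kappa> xs
    by (intro has_vector_derivative_Pair has_vector_derivative_const) (simp add: X_eq)
  have V: "((\<lambda>y. (H \<kappa> (y, s), 0)) has_vector_derivative
      (frechet_derivative (H \<kappa>) (at (x, s) within Dom \<kappa>) (1, 0), 0)) (at x)"
    using space_derivative[OF \<kappa>(1) H_smooth[OF \<kappa>(1)], of x s] \<kappa>(2) xs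
    by (intro has_vector_derivative_Pair has_vector_derivative_const) simp
  have "((\<lambda>y. ST \<kappa> (\<phi> \<kappa> (y, s), s) (H \<kappa> (y, s), 0) (H \<kappa> (y, s), 0)) has_real_derivative 2 * ip W0 h) (at x)"
    using ST.norm_sq_derivative_along[OF open_slice[OF \<kappa>(1) s] x D \<gamma> V] by (simp add: W0_def ip_def h_def xs)
  then have "((\<lambda>y. K (y, s)) has_real_derivative 2 * ip W0 h) (at x)"
    by (rule has_field_derivative_transform_within_open[OF _ open_slice[OF \<kappa>(1) s] x])
      (use K_eq[OF \<kappa>(1)] in \<open>auto simp: ST_eq\<close>)
  then have "dx T K z = 2 * ip W0 h"
    using DERIV_unique[OF dx_dt(1)[OF K_smooth s]] xs by blast
  \<comment> \<open>Since \<open>H\<close> is orthogonal to \<open>S\<close>, removing the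
    tangential part of \<open>W\<close> does not change its pairing with \<open>h\<close>; the root
    of \<open>P z\<close> passes from arc length to the parameter.\<close>
  also have "ip W0 h = sqrt (P z) * ip n h"
  proof -
    have "ip (S \<kappa> z, 0) h = 0"
      using curve_geometry(1)[OF \<kappa>(1), of x s] \<kappa>(2) xs inner_formD(2)[OF ip, of "(S \<kappa> z, 0)" h]
      by (simp add: ip_def h_def ST_eq)
    then show ?thesis by (simp add: W n_def bilinear_lsub[OF bil] bilinear_lmul[OF bil] del: scaleR_Pair)
  qed
  finally have "(dx T K z)\<^sup>2 = 4 * P z * (ip n h)\<^sup>2"
    using P_pos[OF z] by (simp add: power_mult_distrib)
  also have "\<dots> \<le> 4 * P z * (ip n n * ip h h)"
    using P_pos[OF z] by (intro mult_left_mono inner_form_Cauchy_Schwarz[OF ip]) auto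
  finally show "(dx T K z)\<^sup>2 \<le> 4 * P z * (N z * K z)" unfolding N K .
qed

section \<open>Periodicity and the intrinsic derivatives in terms of partial derivatives\<close>

lemma curve_periodic: "s \<in> {0..T} \<Longrightarrow> c (x + 2 * pi, s) = c (x, s)"
  using immersed by (simp add: immersed_curve_family_def)

text \<open>The points at \<open>x\<close> and \<open>x + 2 * pi\<close> coincide, so one chart
  serves for both. The vectors \<open>X\<close> agree as derivatives of the same periodic function,
  and the vectors \<open>H\<close> agree because both are the velocity of the same coordinate curve
  in time.\<close>

lemma periodic:
  assumes s: "s \<in> {0..T}"
  shows "P (x + 2 * pi, s) = P (x, s)" "K (x + 2 * pi, s) = K (x, s)"
proof -
  let ?\<kappa> = "chart_at A (c (x, s))" and ?p = "2 * pi"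
  have z: "(x, s) \<in> strip T" "(x + ?p, s) \<in> strip T" using s by auto
  note \<kappa> = strip_chart[OF z(1)]
  have z': "(x + ?p, s) \<in> Dom ?\<kappa>" using \<kappa>(2) curve_periodic[OF s, of x] s by auto
  have "((\<lambda>y. \<phi> ?\<kappa> (y, s)) has_vector_derivative X ?\<kappa> (x + ?p, s)) (at (x + ?p))"
    unfolding X_eq[OF \<kappa>(1) z'] by (rule space_derivative[OF \<kappa>(1) \<phi>_smooth[OF \<kappa>(1)] z'])
  moreover have "((\<lambda>y. y + ?p) has_vector_derivative 1) (at x)"
    using has_vector_derivative_add[OF has_vector_derivative_id has_vector_derivative_const] by simp
  ultimately have "((\<lambda>y. \<phi> ?\<kappa> (y + ?p, s)) has_vector_derivative X ?\<kappa> (x + ?p, s)) (at x)"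
    using vector_diff_chain_at[of "\<lambda>y. y + ?p" 1 x "\<lambda>y. \<phi> ?\<kappa> (y, s)"] by (simp add: o_def)
  then have "((\<lambda>y. \<phi> ?\<kappa> (y, s)) has_vector_derivative X ?\<kappa> (x + ?p, s)) (at x)"
    using curve_periodic[OF s] by simp
  moreover have "((\<lambda>y. \<phi> ?\<kappa> (y, s)) has_vector_derivative X ?\<kappa> (x, s)) (at x)"
    unfolding X_eq[OF \<kappa>] by (rule space_derivative[OF \<kappa>(1) \<phi>_smooth[OF \<kappa>(1)] \<kappa>(2)])
  ultimately have X: "X ?\<kappa> (x + ?p, s) = X ?\<kappa> (x, s)" by (metis vector_derivative_at)
  show "P (x + 2 * pi, s) = P (x, s)"
    using P_eq[OF \<kappa>] P_eq[OF \<kappa>(1) z'] X curve_periodic[OF s] by simp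
  have flow: "((\<lambda>r. \<phi> ?\<kappa> (y, r)) has_vector_derivative H ?\<kappa> (y, s)) (at s within {0..T})"
    if "(y, s) \<in> Dom ?\<kappa>" for y
    unfolding H_eq[OF \<kappa>(1) that] by (rule time_derivative[OF \<kappa>(1) \<phi>_smooth[OF \<kappa>(1)] that])
  have "((\<lambda>r. \<phi> ?\<kappa> (x, r)) has_vector_derivative H ?\<kappa> (x + ?p, s)) (at s within {0..T})"
    by (rule has_vector_derivative_transform[OF s _ flow[OF z']]) (simp add: curve_periodic)
  then have "H ?\<kappa> (x + ?p, s) = H ?\<kappa> (x, s)"
    using vector_derivative_unique_within_closed_interval[of 0 T s] flow[OF \<kappa>(2)] T_pos s by auto
  then show "K (x + 2 * pi, s) = K (x, s)"
    using K_eq[OF \<kappa>] K_eq[OF \<kappa>(1) z'] curve_periodic[OF s] by simp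
qed

lemma speed_eq: "z \<in> strip T \<Longrightarrow> speed A g c z = sqrt (P z)"
  and curvature_eq: "z \<in> strip T \<Longrightarrow> curvature A g c z = sqrt (K z)"
proof -
  assume z: "z \<in> strip T"
  let ?\<kappa> = "chart_at A (c z)"
  note \<kappa> = strip_chart[OF z]
  show "speed A g c z = sqrt (P z)" "curvature A g c z = sqrt (K z)"
    by (simp_all add: P_eq[OF \<kappa>] K_eq[OF \<kappa>] speed_def curvature_def length_in_def Let_def split_def)
qed

lemma arc_deriv_K:
  assumes s: "s \<in> {0..T}"
  shows "arc_deriv A g c K (x, s) = dx T K (x, s) / sqrt (P (x, s))"
  using DERIV_imp_deriv[OF dx_dt(1)[OF K_smooth s]] s by (simp add: arc_deriv_def speed_eq)

lemma arc_deriv_arc_deriv_K: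
  assumes s: "s \<in> {0..T}"
  shows "arc_deriv A g c (arc_deriv A g c K) (x, s) =
    deriv (\<lambda>y. dx T K (y, s) / sqrt (P (y, s))) x / sqrt (P (x, s))"
  using s by (simp add: arc_deriv_def[of A g c "arc_deriv A g c K"] arc_deriv_K speed_eq)

lemma time_deriv_K:
  assumes s: "s \<in> {0..T}"
  shows "time_deriv T K (x, s) = dt T K (x, s)"
  using vector_derivative_within_cbox[of 0 T s] dx_dt(2)[OF K_smooth s, of x] T_pos s
  by (simp add: time_deriv_def has_real_derivative_iff_has_vector_derivative)

end

section \<open>From the scalar inequalities to length and total curvature\<close>

lemma upper_deriv_cong:
  assumes "t \<in> I" "\<And>s. s \<in> I \<Longrightarrow> f s = f' s"
  shows "upper_deriv f t I = upper_deriv f' t I"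
  unfolding upper_deriv_def using assms
  by (intro Limsup_eq) (auto simp: eventually_at_filter)

theorem lemma0p4:
  fixes A :: "('m::t2_space, 'a::euclidean_space) chart set"
    and g :: "real \<Rightarrow> ('m, 'a) metric"
    and T Chat C1 C2 :: real
    and c :: "'m curves"
    and t :: real
  assumes "compact (UNIV :: 'm set)"
    and "smooth_atlas A"
    and "0 < T"
    and "ricci_flow A T g"
    and "0 \<le> Chat"
    and "\<And>c' x s. curve_shrinking_flow A T g c' \<Longrightarrow> s \<in> {0..T} \<Longrightarrow>
           time_deriv T (\<lambda>z. (curvature A g c' z)\<^sup>2) (x, s)
           \<le> arc_deriv A g c' (arc_deriv A g c' (\<lambda>z. (curvature A g c' z)\<^sup>2)) (x, s)
             - 2 * normal_cov_curvature_sq A T g c' (x, s)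
             + 2 * curvature A g c' (x, s) ^ 4
             + Chat * ((curvature A g c' (x, s))\<^sup>2 + curvature A g c' (x, s))"
    and "C1 = Chat / 2"
    and "\<And>p s. s \<in> {0..T} \<Longrightarrow> ricci_norm A g s p \<le> C2"
    and "curve_shrinking_flow A T g c"
    and "t \<in> {0..T}"
  shows "(\<exists>L'. (total_length A g c has_real_derivative L') (at t within {0..T}) \<and>
            L' \<le> arc_integral A g c t (\<lambda>z. C2 - (curvature A g c z)\<^sup>2)) \<and>
         upper_deriv (total_curvature A g c) t {0..T}
           \<le> ereal ((C1 + C2) * total_curvature A g c t + C1 * total_length A g c t)"
proof -
  interpret flow A T g c by unfold_locales (rule assms)+
  have K_fun: "K = (\<lambda>z. (curvature A g c z)\<^sup>2)" by (rule ext) (rule K_def)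
  interpret ev: curvature_evolution T C2 Chat K P N
  proof
    \<comment> \<open>A bound on a norm at a single point of the flow already forces
      \<open>C2\<close> to be nonnegative, which the limit in the regularization uses.\<close>
    have "0 \<le> ricci_norm A g 0 (c (0, 0))"
      by (simp add: ricci_norm_def tensor_norm_def Let_def sum_nonneg)
    also have "\<dots> \<le> C2" using assms(3) by (intro assms(8)) simp
    finally show "0 \<le> C2" .
    show "dt T P z \<le> 2 * P z * (C2 - K z)" if "z \<in> strip T" for z
      using that by (intro P_evolution assms(8)) auto
    show "dt T K (x, s) \<le> deriv (\<lambda>y. dx T K (y, s) / sqrt (P (y, s))) x / sqrt (P (x, s))
        - 2 * N (x, s) + 2 * (K (x, s))\<^sup>2 + Chat * (K (x, s) + sqrt (K (x, s)))"
      if s: "s \<in> {0..T}" for x s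
    proof -
      have k: "curvature A g c (x, s) = sqrt (K (x, s))" using s by (intro curvature_eq) simp
      \<comment> \<open>The assumed inequality is phrased in \<open>k\<close>; the analytic part
        needs it in terms of the smooth function \<open>K\<close> and its square root.\<close>
      have "curvature A g c (x, s) ^ 4 = (K (x, s))\<^sup>2"
        unfolding K_def by (simp flip: power_mult)
      moreover have "(sqrt (K (x, s)))\<^sup>2 = K (x, s)" by (simp add: K_def)
      ultimately show ?thesis
        using assms(6)[OF assms(9) s, of x] unfolding K_fun[symmetric]
        by (simp add: arc_deriv_arc_deriv_K[OF s] time_deriv_K[OF s] K_def[symmetric] k)
    qed
  qed (use assms(3,5) P_smooth K_smooth P_pos K_gradient_N periodic in \<open>simp_all add: K_def\<close>)
  have len: "total_length A g c s = ev.len s" and curv: "total_curvature A g c s = ev.curv s"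
    if "s \<in> {0..T}" for s
    using that by (simp_all add: total_length_def total_curvature_def arc_integral_def ev.len_def
        ev.curv_def speed_eq curvature_eq)
  obtain L' where L': "(ev.len has_real_derivative L') (at t within {0..T})"
    "L' \<le> integral {0..2 * pi} (\<lambda>x. (C2 - K (x, t)) * sqrt (P (x, t)))"
    using ev.length_derivative[OF assms(10)] by blast
  have "(total_length A g c has_real_derivative L') (at t within {0..T})"
    unfolding has_field_derivative_def
    by (rule has_derivative_transform[OF assms(10) _ L'(1)[unfolded has_field_derivative_def]]) (rule len)
  moreover have "L' \<le> arc_integral A g c t (\<lambda>z. C2 - (curvature A g c z)\<^sup>2)"
    using L'(2) assms(10) by (simp add: arc_integral_def speed_eq K_def)
  moreover have "upper_deriv (total_curvature A g c) t {0..T}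
      \<le> ereal ((C1 + C2) * total_curvature A g c t + C1 * total_length A g c t)"
    using ev.curv_upper_deriv[OF assms(10)] upper_deriv_cong[where f = "total_curvature A g c" and f' = ev.curv, OF assms(10) curv]
    by (simp add: assms(7) len[OF assms(10)] curv[OF assms(10)])
  ultimately show ?thesis by blast
qed

end
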